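(* Under the standing setup below, let $\mathbf u(\cdot)$ be any (locally integrable) input signal and $\mathbf d(\cdot)$ any disturbance with $\|\mathbf d(t)\|\le\bar d$ for all $t\ge0$. Let $\mathbf x(t)$ solve $\dot{\mathbf x}=\mathbf A\mathbf x+\mathbf f_{\mathrm{nl}}(\mathbf x)+\mathbf B\mathbf u+\mathbf d$, let $\mathbf z_r(t)$ solve the nominal prediction model $\dot{\mathbf z}_r=\mathbf A_r\mathbf z_r+\mathbf r_{\mathrm{nl}}(\mathbf z_r)+\mathbf B_r\mathbf u$, and let the scalars $s(t),\delta(t)$ solve $$\dot s=\lambda_{\mathbf A_n}s+(1+L_{\mathbf w})(L_{\mathbf f}s+\bar d)+\|\mathbf B_n\mathbf u\|+L_{\mathbf w}\|\mathbf B_r\mathbf u\|,\qquad \dot\delta=(\lambda_{\mathbf A_r}+L_{\mathbf r})\delta+L_{\mathbf f}s+\bar d,$$ with $s(0),\delta(0)\ge0$. With $\mathbf x_r=\mathbf V_r^\top\mathbf x$ and $\tilde{\mathbf x}_n:=\mathbf V_n^\top\mathbf x-\mathbf V_n^\top\mathbf w_{\mathrm{nl}}(\mathbf x_r)$, suppose $\|\tilde{\mathbf x}_n(0)\|\le s(0)$ and $\|\mathbf x_r(0)-\mathbf z_r(0)\|\le\delta(0)$. Then for all $t\ge0$, $$\|\tilde{\mathbf x}_n(t)\|\le s(t),\qquad \|\mathbf x_r(t)-\mathbf z_r(t)\|\le\delta(t).$$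
   Context: Standing setup. Let $n_f>n\ge1$ and $m\ge1$; $\|\cdot\|$ is the Euclidean norm and its induced matrix norm. Consider $\dot{\mathbf x}(t)=\mathbf A\mathbf x(t)+\mathbf f_{\mathrm{nl}}(\mathbf x(t))+\mathbf B\mathbf u(t)+\mathbf d(t)$ with $\mathbf x\in\mathbb R^{n_f}$, $\mathbf u\in\mathbb R^m$, $\mathbf B\in\mathbb R^{n_f\times m}$, and a disturbance with $\|\mathbf d(t)\|\le\bar d$ for all $t\ge0$. The matrix $\mathbf A$ is Hurwitz, semi-simple, and in real block-diagonal form $\mathbf A=\mathrm{diag}(\mathbf A_r,\mathbf A_n)$ with $\mathbf A_r\in\mathbb R^{n\times n}$, $\mathbf A_n\in\mathbb R^{(n_f-n)\times(n_f-n)}$, each diagonal block being either a real scalar or a $2\times2$ block $\begin{pmatrix}a&b\\-b&a\end{pmatrix}$ (blocks ordered from slowest to fastest modes). The map $\mathbf f_{\mathrm{nl}}:\mathbb R^{n_f}\to\mathbb R^{n_f}$ is $C^\infty$, satisfies $\mathbf f_{\mathrm{nl}}(0)=0$, $D\mathbf f_{\mathrm{nl}}(0)=0$, and is globally $L_{\mathbf f}$-Lipschitz. Let $\mathbf V_r=\begin{bmatrix}\mathbf I_n\\ \mathbf 0\end{bmatrix}\in\mathbb R^{n_f\times n}$, $\mathbf V_n=\begin{bmatrix}\mathbf 0\\ \mathbf I_{n_f-n}\end{bmatrix}\in\mathbb R^{n_f\times(n_f-n)}$, so $\mathbf A_r=\mathbf V_r^\top\mathbf A\mathbf V_r$, $\mathbf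 A_n=\mathbf V_n^\top\mathbf A\mathbf V_n$, and write $\mathbf x_r:=\mathbf V_r^\top\mathbf x$, $\mathbf x_n:=\mathbf V_n^\top\mathbf x$. The manifold (spectral submanifold) is parametrized by $\mathbf W(\mathbf x_r)=\mathbf V_r\mathbf x_r+\mathbf w_{\mathrm{nl}}(\mathbf x_r)$, where $\mathbf w_{\mathrm{nl}}:\mathbb R^n\to\mathbb R^{n_f}$ is continuously differentiable and $L_{\mathbf w}$-Lipschitz, and satisfies (invertibility) $\mathbf V_r^\top\mathbf W(\mathbf x_r)=\mathbf x_r$ for all $\mathbf x_r$, and (invariance) there is a vector field $\mathbf g:\mathbb R^n\to\mathbb R^n$ with $\mathbf A\mathbf W(\mathbf x_r)+\mathbf f_{\mathrm{nl}}(\mathbf W(\mathbf x_r))=D\mathbf W(\mathbf x_r)\,\mathbf g(\mathbf x_r)$ for all $\mathbf x_r\in\mathbb R^n$. Define $\mathbf r_{\mathrm{nl}}(\mathbf x_r):=\mathbf V_r^\top\mathbf f_{\mathrm{nl}}(\mathbf W(\mathbf x_r))$ and $\mathbf r(\mathbf x_r):=\mathbf A_r\mathbf x_r+\mathbf r_{\mathrm{nl}}(\mathbf x_r)$. Additional notation: $\mathbf B_r:=\mathbf V_r^\top\mathbf B$, $\mathbf B_n:=\mathbf V_n^\top\mathbf B$; $\mathbf r_{\mathrm{nl}}$ is $L_{\mathbf r}$-Lipschitz; $\lambda_{\mathbf A_n}$ and $\lambda_{\mathbf A_r}$ denote the largest real part among the eigenvalues of $\mathbf A_n$ and $\mathbf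 A_r$, respectively. *)

theory Defs
  imports "HOL-Analysis.Analysis"
begin

text \<open>Complexification of a real square matrix and its (complex) spectrum:
  the roots of the characteristic polynomial det(lambda I - M).\<close>
definition cmat :: "real^'n^'n \<Rightarrow> complex^'n^'n" where
  "cmat M = (\<chi> i j. complex_of_real (M $ i $ j))"

definition cspec :: "real^'n^'n \<Rightarrow> complex set" where
  "cspec M = {c. det (mat c - cmat M) = 0}"

text \<open>Hurwitz: all eigenvalues have negative real part.\<close>
definition hurwitz :: "real^'n^'n \<Rightarrow> bool" where
  "hurwitz M \<longleftrightarrow> (\<forall>c\<in>cspec M. Re c < 0)"

text \<open>Largest real part among the eigenvalues.\<close>
definition max_re_eig :: "real^'n^'n \<Rightarrow> real" where
  "max_re_eig M = Max (Re ` cspec M)"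

text \<open>Real block-diagonal form: the index set (ordered by the linear order of
  the index type) is split into consecutive blocks of size 1 or 2 via an
  involution p (p i = i: scalar block; p i \<noteq> i: i and p i are adjacent and
  form a 2x2 block [[a,b],[-b,a]]); all entries outside the blocks vanish.
  The blocks are ordered from slowest to fastest, i.e. the real parts
  (diagonal entries) are non-increasing along the index order.\<close>
definition real_block_diag :: "real^('k::{finite,linorder})^('k::{finite,linorder}) \<Rightarrow> bool" where
  "real_block_diag M \<longleftrightarrow> (\<exists>p :: 'k \<Rightarrow> 'k.
      (\<forall>i. p (p i) = i) \<and>
      (\<forall>i k. \<not> (i < k \<and> k < p i)) \<and>
      (\<forall>i j. j \<noteq> i \<and> j \<noteq> p i \<longrightarrow> M $ i $ j = 0) \<and>
      (\<forall>i. p i \<noteq> i \<longrightarrow> M $ (p i) $ (p i) = M $ i $ i \<and> M $ i $ (p i) = - M $ (p i) $ i))"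

definition ordered_slow_to_fast :: "real^('k::{finite,linorder})^('k::{finite,linorder}) \<Rightarrow> bool" where
  "ordered_slow_to_fast M \<longleftrightarrow> (\<forall>i j :: 'k. i \<le> j \<longrightarrow> M $ j $ j \<le> M $ i $ i)"

text \<open>Iterated (Frechet) directional derivatives; C-infinity means all of them
  exist everywhere as Frechet derivatives.\<close>
primrec iter_dderiv :: "('a::real_normed_vector \<Rightarrow> 'b::real_normed_vector) \<Rightarrow> 'a list \<Rightarrow> 'a \<Rightarrow> 'b" where
  "iter_dderiv f [] = f"
| "iter_dderiv f (v # vs) = (\<lambda>x. frechet_derivative (iter_dderiv f vs) (at x) v)"

definition smooth_everywhere :: "('a::real_normed_vector \<Rightarrow> 'b::real_normed_vector) \<Rightarrow> bool" where
  "smooth_everywhere f \<longleftrightarrow> (\<forall>vs x. iter_dderiv f vs differentiable (at x))"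

end

theory Submission
  imports Defs
begin

text \<open>Write xi = x_n tilde and e = x_r - z_r. Both are merely continuous, so instead of
  differentiating their norms we compare them with s and delta one Euler step at a time. Over a
  short step [t, t'], the invariance equation turns xi(t') - xi(t) into (t' - t) A_n xi(t), plus the
  integral of a defect bounded by (1 + L_w)(L_f |xi(t)| + dbar) + |B_n u| + L_w |B_r u| up to small
  errors, minus the linearisation remainder of w_nl, which is small because w_nl is C^1. Since
  the 2x2 blocks of A_n are rotations, |v + h A_n v| \<le> (1 + h lambda_An) |v| + O(h^2). Hence
  |xi| satisfies the differential inequality defining s in Euler form, and a discrete Gronwall
  argument on the excess max (|xi| - s) 0 gives |xi| \<le> s. The same argument with A_r, now
  using |xi| \<le> s, gives |e| \<le> delta.\<close>

section \<open>Real block-diagonal matrices\<close>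

lemma matrix_vector_mult_block_nth:
  fixes M :: "'a::comm_ring_1^'k::finite^'k"
  assumes "\<forall>i j. j \<noteq> i \<and> j \<noteq> p i \<longrightarrow> M $ i $ j = 0"
  shows "(M *v v) $ j = M $ j $ j * v $ j + (if p j \<noteq> j then M $ j $ p j * v $ p j else 0)"
proof -
  have "(M *v v) $ j = (\<Sum>k\<in>UNIV. M $ j $ k * v $ k)"
    by (simp add: matrix_vector_mult_def)
  also have "\<dots> = (\<Sum>k\<in>{j, p j}. M $ j $ k * v $ k)"
    by (rule sum.mono_neutral_right) (use assms in auto)
  also have "\<dots> = M $ j $ j * v $ j + (if p j \<noteq> j then M $ j $ p j * v $ p j else 0)"
    by (cases "p j = j") auto
  finally show ?thesis .
qed

text \<open>The off-diagonal entries of the 2x2 blocks are skew, so they cancel in the quadratic form.\<close>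
lemma real_block_diag_inner_mult_vec_le:
  fixes M :: "real^('k::{finite,linorder})^('k::{finite,linorder})"
  assumes "real_block_diag M" and "\<And>i. M $ i $ i \<le> lam"
  shows "v \<bullet> (M *v v) \<le> lam * (norm v)\<^sup>2"
proof -
  obtain p where p: "\<forall>i. p (p i) = i" and zero: "\<forall>i j. j \<noteq> i \<and> j \<noteq> p i \<longrightarrow> M $ i $ j = 0"
    and skew: "\<forall>i. p i \<noteq> i \<longrightarrow> M $ i $ p i = - M $ p i $ i"
    using assms(1) unfolding real_block_diag_def by blast
  define c where "c i = v $ i * (if p i \<noteq> i then M $ i $ p i * v $ p i else 0)" for i
  have "bij p"
    using p by (metis bijI')
  then have "sum c UNIV = sum (c \<circ> p) UNIV"
    using sum.reindex[of p UNIV c] by (simp add: bij_betw_def)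
  also have "\<dots> = - sum c UNIV"
    unfolding sum_negf[symmetric]
  proof (rule sum.cong[OF refl])
    fix i
    show "(c \<circ> p) i = - c i"
    proof (cases "p i = i")
      case False
      then have "p i \<noteq> p (p i)" using p by metis
      then show ?thesis using False skew p by (auto simp: c_def)
    qed (simp add: c_def)
  qed
  finally have off_diagonal: "sum c UNIV = 0" by simp
  have "v \<bullet> (M *v v) = (\<Sum>i\<in>UNIV. v $ i * (M $ i $ i * v $ i) + c i)"
    unfolding inner_vec_def matrix_vector_mult_block_nth[OF zero] c_def by (simp add: algebra_simps)
  also have "\<dots> = (\<Sum>i\<in>UNIV. M $ i $ i * (v $ i)\<^sup>2)"
    by (simp add: sum.distrib off_diagonal power2_eq_square algebra_simps)
  also have "\<dots> \<le> (\<Sum>i\<in>UNIV. lam * (v $ i)\<^sup>2)"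
    by (rule sum_mono) (simp add: assms(2) mult_right_mono)
  also have "\<dots> = lam * (norm v)\<^sup>2"
    by (simp add: sum_distrib_left norm_vec_def L2_set_def real_norm_def sum_nonneg)
  finally show ?thesis .
qed

lemma det_eq_0_iff_kernel:
  fixes A :: "'a::field^'n::finite^'n"
  shows "det A = 0 \<longleftrightarrow> (\<exists>v. v \<noteq> 0 \<and> A *v v = 0)"
proof -
  have "det A = 0 \<longleftrightarrow> \<not> inj ((*v) A)"
    using invertible_det_nz[of A] invertible_left_inverse[of A] matrix_left_invertible_injective[of A]
    by blast
  also have "\<dots> \<longleftrightarrow> (\<exists>v. v \<noteq> 0 \<and> A *v v = 0)"
  proof
    assume "\<not> inj ((*v) A)"
    then obtain a b where "a \<noteq> b" "A *v a = A *v b" unfolding inj_def by blast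
    then show "\<exists>v. v \<noteq> 0 \<and> A *v v = 0"
      by (intro exI[of _ "a - b"]) (simp add: matrix_vector_mult_diff_distrib)
  next
    assume "\<exists>v. v \<noteq> 0 \<and> A *v v = 0"
    then show "\<not> inj ((*v) A)"
      unfolding inj_def by (metis matrix_vector_mult_0_right)
  qed
  finally show ?thesis .
qed

lemma mat_minus_mult_vec_nth:
  fixes B :: "'a::comm_ring_1^'n::finite^'n"
  shows "((mat c - B) *v v) $ j = c * v $ j - (B *v v) $ j"
proof -
  have "(\<Sum>k\<in>UNIV. (if j = k then c else 0) * v $ k) = c * v $ j"
    by (simp add: if_distrib[where f="\<lambda>x. x * _"] cong: if_cong)
  then show ?thesis
    by (simp add: matrix_vector_mult_def mat_def left_diff_distrib sum_subtractf)
qed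

lemma cmat_mult_vec_block_nth:
  fixes M :: "real^'k::finite^'k"
  assumes "\<forall>i j. j \<noteq> i \<and> j \<noteq> p i \<longrightarrow> M $ i $ j = 0"
  shows "(cmat M *v v) $ j
    = of_real (M $ j $ j) * v $ j + (if p j \<noteq> j then of_real (M $ j $ p j) * v $ p j else 0)"
proof -
  have "\<forall>i j. j \<noteq> i \<and> j \<noteq> p i \<longrightarrow> cmat M $ i $ j = 0"
    using assms by (simp add: cmat_def)
  then have "(cmat M *v v) $ j
      = cmat M $ j $ j * v $ j + (if p j \<noteq> j then cmat M $ j $ p j * v $ p j else 0)"
    by (rule matrix_vector_mult_block_nth)
  then show ?thesis by (simp add: cmat_def)
qed

lemma Re_eq_0_if_square_nonpos_real:
  fixes z :: complex
  assumes "z * z = - of_real (b * b)"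
  shows "Re z = 0"
proof (rule ccontr)
  assume "Re z \<noteq> 0"
  have "Im (z * z) = 0"
    using assms by simp
  with \<open>Re z \<noteq> 0\<close> have "Im z = 0"
    by simp
  with arg_cong[OF assms, of Re] have "Re z * Re z = - (b * b)"
    by simp
  moreover have "0 < Re z * Re z"
    using \<open>Re z \<noteq> 0\<close> by (metis not_real_square_gt_zero)
  ultimately show False
    by (metis neg_0_less_iff_less not_square_less_zero)
qed

lemma Re_eigenvalue_rotation_block:
  fixes c u w :: complex and a b :: real
  assumes "(c - of_real a) * u = of_real b * w" and "(c - of_real a) * w = - of_real b * u"
    and "u \<noteq> 0"
  shows "Re c = a"
proof -
  have "(c - a) * (c - a) * u = (c - a) * (b * w)"
    using assms(1) by (simp add: mult.assoc)
  also have "\<dots> = b * ((c - a) * w)"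
    by (simp add: algebra_simps)
  also have "\<dots> = - of_real (b * b) * u"
    using assms(2) by simp
  finally have "(c - a) * (c - a) = - of_real (b * b)"
    using assms(3) by (metis mult_right_cancel)
  then have "Re (c - a) = 0"
    by (rule Re_eq_0_if_square_nonpos_real)
  then show ?thesis by simp
qed

lemma Re_cspec_real_block_diag:
  fixes M :: "real^('k::{finite,linorder})^('k::{finite,linorder})"
  assumes "real_block_diag M"
  shows "Re ` cspec M \<subseteq> range (\<lambda>i. M $ i $ i)"
proof
  obtain p where p: "\<forall>i. p (p i) = i" and zero: "\<forall>i j. j \<noteq> i \<and> j \<noteq> p i \<longrightarrow> M $ i $ j = 0"
    and skew: "\<forall>i. p i \<noteq> i \<longrightarrow> M $ p i $ p i = M $ i $ i \<and> M $ i $ p i = - M $ p i $ i"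
    using assms unfolding real_block_diag_def by blast
  fix r assume "r \<in> Re ` cspec M"
  then obtain c where c: "c \<in> cspec M" "r = Re c" by blast
  then obtain v where v: "v \<noteq> 0" "(mat c - cmat M) *v v = 0"
    unfolding cspec_def det_eq_0_iff_kernel by blast
  have eigen: "c * v $ j = (cmat M *v v) $ j" for j
    using arg_cong[OF v(2), of "\<lambda>w. w $ j"] by (simp add: mat_minus_mult_vec_nth)
  obtain j where j: "v $ j \<noteq> 0" using v(1) by (metis vec_eq_iff zero_index)
  let ?a = "M $ j $ j" and ?b = "M $ j $ p j"
  have "Re c = ?a"
  proof (cases "p j = j")
    case True
    then have "c * v $ j = of_real ?a * v $ j"
      using eigen[of j] cmat_mult_vec_block_nth[OF zero, of v j] by simp
    then show ?thesis using j by simp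
  next
    case False
    have pj: "p (p j) = j" using p by blast
    have "(c - of_real ?a) * v $ j = of_real ?b * v $ p j"
      using eigen[of j] cmat_mult_vec_block_nth[OF zero, of v j] False by (simp add: algebra_simps)
    moreover have "(c - of_real ?a) * v $ p j = - of_real ?b * v $ j"
    proof -
      have "M $ p j $ p j = ?a" "M $ p j $ j = - ?b"
        using skew False by auto
      then show ?thesis
        using eigen[of "p j"] cmat_mult_vec_block_nth[OF zero, of v "p j"] False pj
        by (auto simp: algebra_simps)
    qed
    ultimately show ?thesis
      using j by (rule Re_eigenvalue_rotation_block)
  qed
  then show "r \<in> range (\<lambda>i. M $ i $ i)" using c by auto
qed

text \<open>Each diagonal entry a is the real part of the eigenvalue a + i b of its block, with
  eigenvector e_i + i e_(p i).\<close>
lemma diag_in_Re_cspec_real_block_diag: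
  fixes M :: "real^('k::{finite,linorder})^('k::{finite,linorder})"
  assumes "real_block_diag M"
  shows "M $ i $ i \<in> Re ` cspec M"
proof -
  obtain p where p: "\<forall>i. p (p i) = i" and zero: "\<forall>i j. j \<noteq> i \<and> j \<noteq> p i \<longrightarrow> M $ i $ j = 0"
    and skew: "\<forall>i. p i \<noteq> i \<longrightarrow> M $ p i $ p i = M $ i $ i \<and> M $ i $ p i = - M $ p i $ i"
    using assms unfolding real_block_diag_def by blast
  note row = cmat_mult_vec_block_nth[OF zero]
  define c where "c = of_real (M $ i $ i) + (if p i \<noteq> i then \<i> * of_real (M $ i $ p i) else 0)"
  define v :: "complex^('k::{finite,linorder})"
    where "v = (\<chi> j. if j = i then 1 else if j = p i \<and> p i \<noteq> i then \<i> else 0)"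
  have vi: "v $ i = 1" by (simp add: v_def)
  have vpi: "v $ p i = \<i>" if "p i \<noteq> i" using that by (simp add: v_def)
  have vo: "v $ j = 0" if "j \<noteq> i" "j \<noteq> p i" for j using that by (simp add: v_def)
  have "((mat c - cmat M) *v v) $ j = 0" for j
  proof -
    have pi: "p (p i) = i" using p by blast
    consider "j = i" "p i = i" | "j = i" "p i \<noteq> i" | "j \<noteq> i" "j = p i" | "j \<noteq> i" "j \<noteq> p i"
      by blast
    then show ?thesis
    proof cases
      case 3
      then have "M $ p i $ p i = M $ i $ i" "M $ p i $ i = - M $ i $ p i" using skew by auto
      then have "((mat c - cmat M) *v v) $ p i
          = c * \<i> - (of_real (M $ i $ i) * \<i> + of_real (- M $ i $ p i) * 1)"
        unfolding mat_minus_mult_vec_nth row using 3 pi vi vpi by simp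
      also have "\<dots> = 0" using 3 by (simp add: c_def algebra_simps)
      finally show ?thesis using 3 by simp
    next
      case 4
      have "p j \<noteq> i" using 4 p by metis
      moreover have "p j \<noteq> p i" using 4 p by metis
      ultimately show ?thesis using 4 vo unfolding mat_minus_mult_vec_nth row by simp
    qed (simp_all add: mat_minus_mult_vec_nth row vi vpi c_def)
  qed
  then have "(mat c - cmat M) *v v = 0" by (simp add: vec_eq_iff)
  moreover have "v \<noteq> 0" using vi by auto
  ultimately have "c \<in> cspec M" unfolding cspec_def det_eq_0_iff_kernel by blast
  moreover have "Re c = M $ i $ i" by (simp add: c_def)
  ultimately show ?thesis by force
qed

lemma real_block_diag_diag_le_max_re_eig:
  fixes M :: "real^('k::{finite,linorder})^('k::{finite,linorder})"
  assumes "real_block_diag M"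
  shows "M $ i $ i \<le> max_re_eig M"
proof -
  have "finite (Re ` cspec M)"
    using Re_cspec_real_block_diag[OF assms] by (rule finite_subset) simp
  then show ?thesis
    unfolding max_re_eig_def using diag_in_Re_cspec_real_block_diag[OF assms] by simp
qed

lemma real_block_diag_inner_le_max_re_eig:
  fixes M :: "real^('k::{finite,linorder})^('k::{finite,linorder})"
  assumes "real_block_diag M"
  shows "v \<bullet> (M *v v) \<le> max_re_eig M * (norm v)\<^sup>2"
  using assms real_block_diag_diag_le_max_re_eig[OF assms] by (rule real_block_diag_inner_mult_vec_le)

section \<open>Elementary norm estimates\<close>

lemma norm_euler_step_le:
  fixes v w :: "'a::real_inner"
  assumes quad: "v \<bullet> w \<le> lam * (norm v)\<^sup>2" and bound: "norm w \<le> C * norm v"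
    and "0 \<le> h" and "h * \<bar>lam\<bar> \<le> 1/2"
  shows "norm (v + h *\<^sub>R w) \<le> (1 + h * lam + h\<^sup>2 * C\<^sup>2) * norm v"
proof -
  have "1/2 \<le> 1 + h * lam"
    using \<open>h * \<bar>lam\<bar> \<le> 1/2\<close> mult_left_mono[OF abs_ge_minus_self[of lam] \<open>0 \<le> h\<close>] by linarith
  have "(norm w)\<^sup>2 \<le> C\<^sup>2 * (norm v)\<^sup>2"
    using bound by (metis norm_ge_zero power_mono power_mult_distrib)
  have "(norm (v + h *\<^sub>R w))\<^sup>2 = (v + h *\<^sub>R w) \<bullet> (v + h *\<^sub>R w)"
    by (simp add: power2_norm_eq_inner)
  also have "\<dots> = v \<bullet> v + 2 * h * (v \<bullet> w) + h\<^sup>2 * (w \<bullet> w)"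
    by (simp add: inner_add_left inner_add_right inner_commute[of w v] power2_eq_square algebra_simps)
  also have "\<dots> = (norm v)\<^sup>2 + 2 * h * (v \<bullet> w) + h\<^sup>2 * (norm w)\<^sup>2"
    by (simp add: power2_norm_eq_inner)
  also have "\<dots> \<le> (norm v)\<^sup>2 + 2 * h * (lam * (norm v)\<^sup>2) + h\<^sup>2 * (C\<^sup>2 * (norm v)\<^sup>2)"
    using quad \<open>(norm w)\<^sup>2 \<le> C\<^sup>2 * (norm v)\<^sup>2\<close> \<open>0 \<le> h\<close> by (intro add_mono mult_left_mono) auto
  also have "\<dots> = (1 + 2 * h * lam + h\<^sup>2 * C\<^sup>2) * (norm v)\<^sup>2"
    by (simp add: algebra_simps)
  also have "\<dots> \<le> (1 + h * lam + h\<^sup>2 * C\<^sup>2)\<^sup>2 * (norm v)\<^sup>2"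
  proof (rule mult_right_mono)
    have "(1 + h * lam + h\<^sup>2 * C\<^sup>2)\<^sup>2
        = 1 + 2 * h * lam + h\<^sup>2 * C\<^sup>2 + ((h * lam)\<^sup>2 + (2 * (1 + h * lam) - 1) * (h\<^sup>2 * C\<^sup>2) + (h\<^sup>2 * C\<^sup>2)\<^sup>2)"
      by (simp add: power2_eq_square algebra_simps)
    moreover have "0 \<le> (2 * (1 + h * lam) - 1) * (h\<^sup>2 * C\<^sup>2)"
      using \<open>1/2 \<le> 1 + h * lam\<close> by simp
    ultimately show "1 + 2 * h * lam + h\<^sup>2 * C\<^sup>2 \<le> (1 + h * lam + h\<^sup>2 * C\<^sup>2)\<^sup>2"
      by (simp add: add_nonneg_nonneg)
  qed simp
  finally have "(norm (v + h *\<^sub>R w))\<^sup>2 \<le> ((1 + h * lam + h\<^sup>2 * C\<^sup>2) * norm v)\<^sup>2"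
    by (simp add: power_mult_distrib)
  moreover have "0 \<le> (1 + h * lam + h\<^sup>2 * C\<^sup>2) * norm v"
    using \<open>1/2 \<le> 1 + h * lam\<close> by simp
  ultimately show ?thesis
    by (rule power2_le_imp_le)
qed

lemma norm_euler_step_le_eps:
  fixes v w :: "'a::real_inner"
  assumes "v \<bullet> w \<le> lam * (norm v)\<^sup>2" and "norm w \<le> C * norm v"
    and "0 \<le> h" and "h * \<bar>lam\<bar> \<le> 1/2" and "h * C\<^sup>2 * norm v \<le> \<epsilon>"
  shows "norm (v + h *\<^sub>R w) \<le> (1 + h * lam) * norm v + \<epsilon> * h"
proof -
  have "h * (h * C\<^sup>2 * norm v) \<le> h * \<epsilon>"
    using assms(3,5) by (rule mult_left_mono[rotated])
  then show ?thesis
    using norm_euler_step_le[OF assms(1-4)] by (simp add: power2_eq_square algebra_simps)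
qed

lemma euler_step_size:
  fixes lam C M \<epsilon> :: real
  assumes "0 \<le> M" and "\<epsilon> > 0"
  obtains \<eta> where "\<eta> > 0"
    and "\<And>h a. 0 \<le> h \<Longrightarrow> h < \<eta> \<Longrightarrow> a \<le> M \<Longrightarrow> h * \<bar>lam\<bar> \<le> 1/2 \<and> h * C\<^sup>2 * a \<le> \<epsilon>"
proof
  show "min (1 / (2 * \<bar>lam\<bar> + 1)) (\<epsilon> / (C\<^sup>2 * M + 1)) > 0"
    using assms by (simp add: add_nonneg_pos)
  fix h a :: real assume "0 \<le> h" "h < min (1 / (2 * \<bar>lam\<bar> + 1)) (\<epsilon> / (C\<^sup>2 * M + 1))" "a \<le> M"
  then have "h * (2 * \<bar>lam\<bar> + 1) < 1" and "h * (C\<^sup>2 * M + 1) < \<epsilon>"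
    using \<open>0 \<le> M\<close> by (simp_all add: pos_less_divide_eq add_nonneg_pos)
  moreover have "h * (C\<^sup>2 * a) \<le> h * (C\<^sup>2 * M)"
    using \<open>0 \<le> h\<close> \<open>a \<le> M\<close> by (simp add: mult_left_mono)
  ultimately show "h * \<bar>lam\<bar> \<le> 1/2 \<and> h * C\<^sup>2 * a \<le> \<epsilon>"
    using \<open>0 \<le> h\<close> by (simp add: algebra_simps)
qed

lemma has_derivative_norm_le_lipschitz:
  assumes deriv: "(f has_derivative f') (at a)" and lip: "C-lipschitz_on UNIV f"
  shows "norm (f' v) \<le> C * norm v"
proof -
  have lin: "bounded_linear f'"
    and approx: "\<And>e. e > 0 \<Longrightarrow> \<exists>d>0. \<forall>y. norm (y - a) < d \<longrightarrow> norm (f y - f a - f' (y - a)) \<le> e * norm (y - a)"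
    using deriv by (auto simp: has_derivative_at_alt)
  have approx_bound: "norm (f' v) \<le> C * norm v + e * norm v" if "e > 0" for e
  proof -
    obtain d where "d > 0" and d: "\<forall>y. norm (y - a) < d \<longrightarrow> norm (f y - f a - f' (y - a)) \<le> e * norm (y - a)"
      using approx[OF \<open>e > 0\<close>] by blast
    define t where "t = d / (2 * (norm v + 1))"
    have "t > 0"
      unfolding t_def using \<open>d > 0\<close> by (intro divide_pos_pos) (auto intro: add_nonneg_pos)
    have "norm v / (2 * (norm v + 1)) < 1"
      by (simp add: add_nonneg_pos pos_divide_less_eq)
    then have "d * (norm v / (2 * (norm v + 1))) < d * 1"
      using \<open>d > 0\<close> by (rule mult_strict_left_mono)
    then have "t * norm v < d"
      by (simp add: t_def)
    then have remainder: "norm (f (a + t *\<^sub>R v) - f a - f' (t *\<^sub>R v)) \<le> e * (t * norm v)"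
      using d[rule_format, of "a + t *\<^sub>R v"] \<open>t > 0\<close> by simp
    have increment: "norm (f (a + t *\<^sub>R v) - f a) \<le> C * (t * norm v)"
      using lipschitz_onD[OF lip, of "a + t *\<^sub>R v" a] \<open>t > 0\<close> by (simp add: dist_norm)
    have "t * norm (f' v) = norm (f' (t *\<^sub>R v))"
      using \<open>t > 0\<close> by (simp add: linear_simps(5)[OF lin])
    also have "\<dots> \<le> norm (f (a + t *\<^sub>R v) - f a) + norm (f (a + t *\<^sub>R v) - f a - f' (t *\<^sub>R v))"
      using norm_triangle_ineq4[of "f (a + t *\<^sub>R v) - f a" "f (a + t *\<^sub>R v) - f a - f' (t *\<^sub>R v)"]
      by simp
    also have "\<dots> \<le> t * (C * norm v + e * norm v)"
      using remainder increment by (simp add: algebra_simps)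
    finally show ?thesis
      using \<open>t > 0\<close> by simp
  qed
  have "0 < norm v + 1"
    by (simp add: add_nonneg_pos)
  show ?thesis
  proof (rule field_le_epsilon)
    fix e :: real assume "e > 0"
    have "norm (f' v) \<le> C * norm v + e / (norm v + 1) * norm v"
      using \<open>e > 0\<close> \<open>0 < norm v + 1\<close> by (intro approx_bound divide_pos_pos)
    also have "e / (norm v + 1) * norm v \<le> e"
      using \<open>e > 0\<close> \<open>0 < norm v + 1\<close> by (simp add: field_simps)
    finally show "norm (f' v) \<le> C * norm v + e" by simp
  qed
qed

lemma continuous_derivative_uniform_remainder:
  fixes w :: "'a::euclidean_space \<Rightarrow> 'b::real_normed_vector" and w' :: "'a \<Rightarrow> 'a \<Rightarrow>\<^sub>L 'b"
  assumes deriv: "\<forall>a. (w has_derivative blinfun_apply (w' a)) (at a)"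
    and cont: "continuous_on UNIV w'" and "\<epsilon> > 0"
  obtains \<delta> where "\<delta> > 0"
    and "\<And>a y. norm a \<le> M \<Longrightarrow> norm (y - a) < \<delta> \<Longrightarrow> norm (w y - w a - w' a (y - a)) \<le> \<epsilon> * norm (y - a)"
proof -
  define K where "K = cball (0::'a) (\<bar>M\<bar> + 1)"
  have "uniformly_continuous_on K w'"
    by (rule compact_uniformly_continuous[OF continuous_on_subset[OF cont]]) (auto simp: K_def)
  then obtain \<delta>\<^sub>0 where "\<delta>\<^sub>0 > 0" and unif: "\<forall>p\<in>K. \<forall>q\<in>K. dist q p < \<delta>\<^sub>0 \<longrightarrow> dist (w' q) (w' p) < \<epsilon>"
    using \<open>\<epsilon> > 0\<close> unfolding uniformly_continuous_on_def by metis
  define \<delta> where "\<delta> = min \<delta>\<^sub>0 1"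
  show ?thesis
  proof (rule that)
    show "\<delta> > 0" using \<open>\<delta>\<^sub>0 > 0\<close> by (simp add: \<delta>_def)
    fix a y :: 'a assume a: "norm a \<le> M" and y: "norm (y - a) < \<delta>"
    have "norm (w y - w a - w' a (y - a)) \<le> norm (y - a) * \<epsilon>"
    proof (rule differentiable_bound_linearization[where S="ball a \<delta>" and f'="\<lambda>z. blinfun_apply (w' z)"])
      fix t :: real assume "t \<in> {0..1}"
      then have "norm (t *\<^sub>R (y - a)) \<le> norm (y - a)" by (auto simp: mult_left_le_one_le)
      then show "a + t *\<^sub>R (y - a) \<in> ball a \<delta>" using y by (simp add: dist_norm)
    next
      fix z assume "z \<in> ball a \<delta>"
      then show "(w has_derivative blinfun_apply (w' z)) (at z within ball a \<delta>)"
        using deriv has_derivative_at_withinI by blast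
    next
      fix z assume z: "z \<in> ball a \<delta>"
      have "norm z \<le> norm a + norm (z - a)"
        by (metis add.commute diff_add_cancel norm_triangle_ineq)
      moreover have "norm (z - a) < 1" using z by (simp add: dist_norm norm_minus_commute \<delta>_def)
      ultimately have "a \<in> K" "z \<in> K" using a by (simp_all add: K_def)
      moreover have "dist z a < \<delta>\<^sub>0" using z by (simp add: dist_commute \<delta>_def)
      ultimately have "dist (w' z) (w' a) < \<epsilon>" using unif by blast
      then show "onorm (blinfun_apply (w' z) - blinfun_apply (w' a)) \<le> \<epsilon>"
        by (simp add: dist_norm norm_blinfun.rep_eq blinfun.diff_left[abs_def] fun_diff_def)
    qed (use \<open>\<delta> > 0\<close> in simp)
    then show "norm (w y - w a - w' a (y - a)) \<le> \<epsilon> * norm (y - a)" by (simp add: mult.commute)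
  qed
qed

lemma norm_mult_vec_le_onorm:
  fixes M :: "real^'n::finite^'m::finite"
  shows "norm (M *v v) \<le> onorm ((*v) M) * norm v"
  using onorm[OF matrix_vector_mul_bounded_linear] .

lemma onorm_mult_vec_nonneg:
  fixes M :: "real^'n::finite^'m::finite"
  shows "0 \<le> onorm ((*v) M)"
  using onorm_pos_le[OF matrix_vector_mul_bounded_linear] .

lemma norm_fst_le_norm: "norm (fst z) \<le> norm z"
  by (metis norm_fst_le prod.collapse)

lemma norm_snd_le_norm: "norm (snd z) \<le> norm z"
  by (metis norm_snd_le prod.collapse)

section \<open>Integral solutions and a comparison principle\<close>

lemma continuous_on_Icc_uniform_modulus:
  fixes f :: "real \<Rightarrow> 'a::metric_space"
  assumes "continuous_on {a..b} f" and "e > 0"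
  obtains d where "d > 0" and "\<And>x x'. x \<in> {a..b} \<Longrightarrow> x' \<in> {a..b} \<Longrightarrow> \<bar>x' - x\<bar> < d \<Longrightarrow> dist (f x') (f x) < e"
proof -
  have "uniformly_continuous_on {a..b} f"
    using assms(1) by (rule compact_uniformly_continuous) simp
  then show ?thesis
    using assms(2) that unfolding uniformly_continuous_on_def dist_real_def by metis
qed

lemma continuous_on_Icc_norm_bound:
  fixes f :: "real \<Rightarrow> 'a::real_normed_vector"
  assumes "continuous_on {a..b} f"
  obtains B where "0 \<le> B" and "\<And>t. t \<in> {a..b} \<Longrightarrow> norm (f t) \<le> B"
proof -
  have "bounded (f ` {a..b})"
    using assms by (intro compact_imp_bounded compact_continuous_image compact_Icc)
  then obtain B where "0 < B" and "\<forall>y\<in>f ` {a..b}. norm y \<le> B"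
    unfolding bounded_pos by blast
  then show ?thesis
    using that[of B] by auto
qed

definition integral_solution :: "(real \<Rightarrow> 'a::banach) \<Rightarrow> (real \<Rightarrow> 'a) \<Rightarrow> bool" where
  "integral_solution f y \<longleftrightarrow> (\<forall>t\<ge>0. (f has_integral (y t - y 0)) {0..t})"

lemma integral_solution_integrable:
  "integral_solution f y \<Longrightarrow> 0 \<le> T \<Longrightarrow> f integrable_on {0..T}"
  unfolding integral_solution_def by blast

lemma integral_solution_continuous_on:
  assumes "integral_solution f y" and "0 \<le> T"
  shows "continuous_on {0..T} y"
proof -
  have "continuous_on {0..T} (\<lambda>t. y 0 + integral {0..t} f)"
    using assms by (intro continuous_intros indefinite_integral_continuous_1 integral_solution_integrable)
  moreover have "y 0 + integral {0..t} f = y t" if "t \<in> {0..T}" for t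
  proof -
    have "(f has_integral (y t - y 0)) {0..t}"
      using assms(1) that unfolding integral_solution_def by auto
    then show ?thesis by (simp add: integral_unique)
  qed
  ultimately show ?thesis by (rule continuous_on_eq)
qed

lemma integral_solution_increment:
  assumes "integral_solution f y" and "0 \<le> t" and "t \<le> t'"
  shows "(f has_integral (y t' - y t)) {t..t'}"
proof -
  have y_t': "(f has_integral (y t' - y 0)) {0..t'}" and y_t: "(f has_integral (y t - y 0)) {0..t}"
    using assms unfolding integral_solution_def by auto
  then have "f integrable_on {0..t'}" by blast
  then have "integral {t..t'} f = integral {0..t'} f - integral {0..t} f"
    and "f integrable_on {t..t'}"
    using Henstock_Kurzweil_Integration.integral_combine[OF assms(2,3)]
      integrable_subinterval_real[of f 0 t' t t'] assms(2) by (auto simp: algebra_simps)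
  moreover have "integral {0..t'} f - integral {0..t} f = y t' - y t"
    using y_t y_t' by (simp add: integral_unique)
  ultimately show ?thesis by (metis has_integral_integrable_integral)
qed

lemma integral_solution_affine_integrable:
  fixes S q :: "real \<Rightarrow> real"
  assumes sol: "integral_solution (\<lambda>\<tau>. k * S \<tau> + q \<tau>) S" and "0 \<le> T"
  shows "q integrable_on {0..T}"
proof -
  have "(\<lambda>\<tau>. (k * S \<tau> + q \<tau>) - k * S \<tau>) integrable_on {0..T}"
    using integral_solution_integrable[OF sol \<open>0 \<le> T\<close>]
      integrable_continuous_interval[OF integral_solution_continuous_on[OF sol \<open>0 \<le> T\<close>]]
    by (intro integrable_diff integrable_cmul[where 'b=real, simplified])
  then show ?thesis by simp
qed

lemma integral_solution_euler_step:
  fixes S q :: "real \<Rightarrow> real"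
  assumes sol: "integral_solution (\<lambda>\<tau>. k * S \<tau> + q \<tau>) S" and "0 \<le> T" and "\<epsilon> > 0"
  obtains \<eta> where "\<eta> > 0" and "\<And>t t'. 0 \<le> t \<Longrightarrow> t \<le> t' \<Longrightarrow> t' \<le> T \<Longrightarrow> t' - t < \<eta> \<Longrightarrow>
    \<bar>S t' - S t - (t' - t) * k * S t - integral {t..t'} q\<bar> \<le> \<epsilon> * (t' - t)"
proof -
  note q_int = integral_solution_affine_integrable[OF sol \<open>0 \<le> T\<close>]
  have "\<epsilon> / (\<bar>k\<bar> + 1) > 0"
    using \<open>\<epsilon> > 0\<close> by simp
  obtain \<eta> where "\<eta> > 0" and modulus: "\<And>\<tau> t. \<tau> \<in> {0..T} \<Longrightarrow> t \<in> {0..T} \<Longrightarrow> \<bar>t - \<tau>\<bar> < \<eta> \<Longrightarrow>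
      dist (S t) (S \<tau>) < \<epsilon> / (\<bar>k\<bar> + 1)"
    using continuous_on_Icc_uniform_modulus[OF integral_solution_continuous_on[OF sol \<open>0 \<le> T\<close>]
        \<open>\<epsilon> / (\<bar>k\<bar> + 1) > 0\<close>] by blast
  show ?thesis
  proof (rule that[OF \<open>\<eta> > 0\<close>])
    fix t t' assume t: "0 \<le> t" "t \<le> t'" "t' \<le> T" "t' - t < \<eta>"
    have "q integrable_on {t..t'}"
      using integrable_subinterval_real[OF q_int] t by auto
    then have q_integral: "(q has_integral integral {t..t'} q) {t..t'}"
      by (rule integrable_integral)
    have "((\<lambda>\<tau>. k * S \<tau> - k * S t)
        has_integral (S t' - S t - (t' - t) * k * S t - integral {t..t'} q)) {t..t'}"
      using has_integral_diff[OF has_integral_diff[OF integral_solution_increment[OF sol t(1,2)]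
          has_integral_const_real[of "k * S t" t t']] q_integral] t(2)
      by (simp add: algebra_simps)
    moreover have "norm (k * S \<tau> - k * S t) \<le> \<bar>k\<bar> * (\<epsilon> / (\<bar>k\<bar> + 1))"
      if "\<tau> \<in> {t..t'}" for \<tau>
    proof -
      have "\<bar>S \<tau> - S t\<bar> \<le> \<epsilon> / (\<bar>k\<bar> + 1)"
        using modulus[of t \<tau>] that t by (auto simp: dist_real_def)
      then have "\<bar>k\<bar> * \<bar>S \<tau> - S t\<bar> \<le> \<bar>k\<bar> * (\<epsilon> / (\<bar>k\<bar> + 1))"
        by (rule mult_left_mono) simp
      then show ?thesis
        by (simp add: abs_mult flip: right_diff_distrib)
    qed
    ultimately have "norm (S t' - S t - (t' - t) * k * S t - integral {t..t'} q)
        \<le> \<bar>k\<bar> * (\<epsilon> / (\<bar>k\<bar> + 1)) * Henstock_Kurzweil_Integration.content {t..t'}"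
      using \<open>\<epsilon> > 0\<close> by (intro has_integral_bound_real[where S="{}"]) auto
    also have "\<dots> \<le> \<epsilon> * (t' - t)"
    proof -
      have "\<bar>k\<bar> * (\<epsilon> / (\<bar>k\<bar> + 1)) \<le> \<epsilon>"
        using \<open>\<epsilon> > 0\<close> by (simp add: field_simps)
      then have "\<bar>k\<bar> * (\<epsilon> / (\<bar>k\<bar> + 1)) * (t' - t) \<le> \<epsilon> * (t' - t)"
        by (rule mult_right_mono) (use t(2) in simp)
      then show ?thesis
        using t(2) by simp
    qed
    finally show "\<bar>S t' - S t - (t' - t) * k * S t - integral {t..t'} q\<bar> \<le> \<epsilon> * (t' - t)"
      by simp
  qed
qed

lemma discrete_gronwall:
  fixes P R :: "real \<Rightarrow> real" and K h \<epsilon> :: real and n :: nat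
  assumes "0 \<le> K" and "0 \<le> h" and "0 \<le> \<epsilon>" and "P 0 \<le> 0" and R: "mono_on {0..n * h} R"
    and step: "\<And>j. j < n \<Longrightarrow>
      P (Suc j * h) \<le> (1 + K * h) * P (j * h) + \<epsilon> * (h + (R (Suc j * h) - R (j * h)))"
  shows "P (n * h) \<le> \<epsilon> * (exp (K * (n * h)) * (n * h + R (n * h) - R 0))"
proof -
  have "P (j * h) \<le> \<epsilon> * (exp (K * (j * h)) * (j * h + R (j * h) - R 0))" if "j \<le> n" for j
    using that
  proof (induction j)
    case 0
    then show ?case using \<open>P 0 \<le> 0\<close> by simp
  next
    case (Suc j)
    define t t' where "t = real j * h" and "t' = real (Suc j) * h"
    have "0 \<le> t" "t \<le> t'" "t' - t = h"
      using \<open>0 \<le> h\<close> by (simp_all add: t_def t'_def algebra_simps)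
    have "t' \<le> n * h"
      using Suc.prems \<open>0 \<le> h\<close> unfolding t'_def by (intro mult_right_mono) simp_all
    then have R_t: "R 0 \<le> R t" and R_t': "R t \<le> R t'"
      using mono_onD[OF R] \<open>0 \<le> t\<close> \<open>t \<le> t'\<close> by simp_all
    define B where "B = \<epsilon> * (exp (K * t) * (t + R t - R 0))"
    have "0 \<le> B"
      using \<open>0 \<le> \<epsilon>\<close> \<open>0 \<le> t\<close> R_t by (simp add: B_def)
    have "(1 + K * h) * P t \<le> (1 + K * h) * B"
      using Suc \<open>0 \<le> K\<close> \<open>0 \<le> h\<close> by (intro mult_left_mono) (simp_all add: B_def t_def)
    also have "\<dots> \<le> exp (K * h) * B"
      using \<open>0 \<le> B\<close> by (intro mult_right_mono) simp_all
    finally have "(1 + K * h) * P t \<le> exp (K * h) * B" .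
    moreover have "1 * (\<epsilon> * (h + (R t' - R t))) \<le> exp (K * t') * (\<epsilon> * (h + (R t' - R t)))"
      using \<open>0 \<le> K\<close> \<open>0 \<le> t\<close> \<open>t \<le> t'\<close> \<open>0 \<le> \<epsilon>\<close> \<open>0 \<le> h\<close> R_t' by (intro mult_right_mono) simp_all
    moreover have "P t' \<le> (1 + K * h) * P t + \<epsilon> * (h + (R t' - R t))"
      using step[of j] Suc.prems by (simp add: t_def t'_def)
    ultimately have "P t' \<le> exp (K * h) * B + exp (K * t') * (\<epsilon> * (h + (R t' - R t)))"
      by linarith
    also have "\<dots> = \<epsilon> * (exp (K * t') * (t' + R t' - R 0))"
      using \<open>t' - t = h\<close> by (simp add: B_def algebra_simps flip: exp_add)
    finally show ?case by (simp add: t'_def)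
  qed
  then show ?thesis by simp
qed

lemma discrete_gronwall_nonpos:
  fixes P R :: "real \<Rightarrow> real"
  assumes "0 \<le> T" and "0 \<le> K" and "P 0 \<le> 0" and R: "mono_on {0..T} R"
    and step: "\<And>\<epsilon>. \<epsilon> > 0 \<Longrightarrow> \<exists>\<eta>>0. \<forall>t t'. 0 \<le> t \<longrightarrow> t \<le> t' \<longrightarrow> t' \<le> T \<longrightarrow> t' - t < \<eta> \<longrightarrow>
      P t' \<le> (1 + K * (t' - t)) * P t + \<epsilon> * ((t' - t) + (R t' - R t))"
  shows "P T \<le> 0"
proof -
  define C where "C = exp (K * T) * (T + R T - R 0)"
  have bound: "P T \<le> \<epsilon> * C" if "\<epsilon> > 0" for \<epsilon>
  proof -
    obtain \<eta> where "\<eta> > 0" and step\<eta>: "\<forall>t t'. 0 \<le> t \<longrightarrow> t \<le> t' \<longrightarrow> t' \<le> T \<longrightarrow> t' - t < \<eta> \<longrightarrow>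
        P t' \<le> (1 + K * (t' - t)) * P t + \<epsilon> * ((t' - t) + (R t' - R t))"
      using step[OF \<open>\<epsilon> > 0\<close>] by blast
    define n :: nat where "n = nat \<lceil>T / \<eta>\<rceil> + 1"
    define h where "h = T / n"
    have "n > 0" by (simp add: n_def)
    then have n_h: "n * h = T" by (simp add: h_def)
    have "T / \<eta> < n" unfolding n_def by linarith
    then have "h < \<eta>" using \<open>n > 0\<close> \<open>\<eta> > 0\<close> by (simp add: h_def field_simps)
    have "0 \<le> h" using \<open>0 \<le> T\<close> by (simp add: h_def)
    have "P (n * h) \<le> \<epsilon> * (exp (K * (n * h)) * (n * h + R (n * h) - R 0))"
    proof (rule discrete_gronwall)
      fix j assume "j < n"
      then have "Suc j * h \<le> T"
        using \<open>0 \<le> h\<close> n_h by (metis Suc_leI mult_right_mono of_nat_le_iff)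
      then show "P (Suc j * h) \<le> (1 + K * h) * P (j * h) + \<epsilon> * (h + (R (Suc j * h) - R (j * h)))"
        using step\<eta>[rule_format, of "j * h" "Suc j * h"] \<open>0 \<le> h\<close> \<open>h < \<eta>\<close>
        by (simp add: algebra_simps)
    qed (use \<open>0 \<le> K\<close> \<open>0 \<le> h\<close> \<open>\<epsilon> > 0\<close> \<open>P 0 \<le> 0\<close> R n_h in auto)
    then show ?thesis by (simp add: n_h C_def)
  qed
  have "0 \<le> C"
    using mono_onD[OF R, of 0 T] \<open>0 \<le> T\<close> by (simp add: C_def)
  show ?thesis
  proof (rule field_le_epsilon)
    fix e :: real assume "e > 0"
    have "P T \<le> e / (C + 1) * C"
      using \<open>e > 0\<close> \<open>0 \<le> C\<close> by (intro bound) simp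
    also have "\<dots> \<le> e"
      using \<open>e > 0\<close> \<open>0 \<le> C\<close> by (simp add: field_simps)
    finally show "P T \<le> 0 + e" by simp
  qed
qed

lemma norm_has_integral_le_affine:
  fixes f :: "real \<Rightarrow> 'a::banach"
  assumes "(f has_integral I) {a..b}" and "g integrable_on {a..b}" and "a \<le> b"
    and "\<And>\<tau>. \<tau> \<in> {a..b} \<Longrightarrow> norm (f \<tau>) \<le> c + g \<tau>"
  shows "norm I \<le> (b - a) * c + integral {a..b} g"
proof -
  have "(\<lambda>\<tau>. c + g \<tau>) integrable_on {a..b}"
    using assms(2) by (intro integrable_add integrable_const_ivl)
  then have "norm (integral {a..b} f) \<le> integral {a..b} (\<lambda>\<tau>. c + g \<tau>)"
    using assms(1,4) by (intro integral_norm_bound_integral) auto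
  then show ?thesis
    using assms(1-3) integral_add[OF integrable_const_ivl assms(2), of c] by (simp add: integral_unique)
qed

text \<open>The differential inequality N' \<le> k N + q on [0, T] in Euler form, up to errors
  o(dt + \<rho> dt); it makes sense for N that is merely continuous.\<close>
definition euler_subsolution ::
    "real \<Rightarrow> real \<Rightarrow> (real \<Rightarrow> real) \<Rightarrow> (real \<Rightarrow> real) \<Rightarrow> (real \<Rightarrow> real) \<Rightarrow> bool" where
  "euler_subsolution T k q \<rho> N \<longleftrightarrow> (\<forall>\<epsilon>>0. \<exists>\<eta>>0. \<forall>t t'. 0 \<le> t \<longrightarrow> t \<le> t' \<longrightarrow> t' \<le> T \<longrightarrow> t' - t < \<eta> \<longrightarrow>
     N t' \<le> N t + (t' - t) * k * N t + integral {t..t'} q + \<epsilon> * ((t' - t) + integral {t..t'} \<rho>))"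

lemma integral_nonneg_everywhere:
  fixes f :: "real \<Rightarrow> real"
  assumes "\<And>x. 0 \<le> f x"
  shows "0 \<le> integral S f"
  using assms by (cases "f integrable_on S") (auto intro: integral_nonneg simp: not_integrable_integral)

lemma euler_subsolutionI:
  assumes "\<And>\<tau>. 0 \<le> \<rho> \<tau>" and "0 \<le> C"
    and "\<And>\<epsilon>. \<epsilon> > 0 \<Longrightarrow> \<exists>\<eta>>0. \<forall>t t'. 0 \<le> t \<longrightarrow> t \<le> t' \<longrightarrow> t' \<le> T \<longrightarrow> t' - t < \<eta> \<longrightarrow>
      N t' \<le> N t + (t' - t) * k * N t + integral {t..t'} q + C * \<epsilon> * ((t' - t) + integral {t..t'} \<rho>)"
  shows "euler_subsolution T k q \<rho> N"
  unfolding euler_subsolution_def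
proof (intro allI impI)
  fix \<epsilon> :: real assume "\<epsilon> > 0"
  then obtain \<eta> where "\<eta> > 0" and \<eta>: "\<forall>t t'. 0 \<le> t \<longrightarrow> t \<le> t' \<longrightarrow> t' \<le> T \<longrightarrow> t' - t < \<eta> \<longrightarrow>
      N t' \<le> N t + (t' - t) * k * N t + integral {t..t'} q
        + C * (\<epsilon> / (C + 1)) * ((t' - t) + integral {t..t'} \<rho>)"
    using assms(3)[of "\<epsilon> / (C + 1)"] assms(2) by auto
  have "C * (\<epsilon> / (C + 1)) * ((t' - t) + integral {t..t'} \<rho>) \<le> \<epsilon> * ((t' - t) + integral {t..t'} \<rho>)"
    if "t \<le> t'" for t t'
  proof (rule mult_right_mono)
    show "C * (\<epsilon> / (C + 1)) \<le> \<epsilon>"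
      using \<open>\<epsilon> > 0\<close> \<open>0 \<le> C\<close> by (simp add: field_simps)
    show "0 \<le> (t' - t) + integral {t..t'} \<rho>"
      using that integral_nonneg_everywhere[of \<rho>, OF assms(1)] by (simp add: add_nonneg_nonneg)
  qed
  with \<eta> \<open>\<eta> > 0\<close> show "\<exists>\<eta>>0. \<forall>t t'. 0 \<le> t \<longrightarrow> t \<le> t' \<longrightarrow> t' \<le> T \<longrightarrow> t' - t < \<eta> \<longrightarrow>
      N t' \<le> N t + (t' - t) * k * N t + integral {t..t'} q + \<epsilon> * ((t' - t) + integral {t..t'} \<rho>)"
    by (meson order_trans add_left_mono)
qed

lemma euler_subsolution_excess_step:
  fixes N S q \<rho> :: "real \<Rightarrow> real"
  assumes "0 \<le> T" and sol: "integral_solution (\<lambda>\<tau>. k * S \<tau> + q \<tau>) S"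
    and "\<And>\<tau>. 0 \<le> \<rho> \<tau>" and sub: "euler_subsolution T k q \<rho> N" and "\<epsilon> > 0"
  obtains \<eta> where "\<eta> > 0" and "\<And>t t'. 0 \<le> t \<Longrightarrow> t \<le> t' \<Longrightarrow> t' \<le> T \<Longrightarrow> t' - t < \<eta> \<Longrightarrow>
    max (N t' - S t') 0 \<le> (1 + \<bar>k\<bar> * (t' - t)) * max (N t - S t) 0 + \<epsilon> * ((t' - t) + integral {t..t'} \<rho>)"
proof -
  have "\<epsilon> / 2 > 0"
    using \<open>\<epsilon> > 0\<close> by simp
  from sub[unfolded euler_subsolution_def, rule_format, OF this]
  obtain \<eta>\<^sub>N where "\<eta>\<^sub>N > 0" and N_step: "\<forall>t t'. 0 \<le> t \<longrightarrow> t \<le> t' \<longrightarrow> t' \<le> T \<longrightarrow> t' - t < \<eta>\<^sub>N \<longrightarrow>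
      N t' \<le> N t + (t' - t) * k * N t + integral {t..t'} q + \<epsilon> / 2 * ((t' - t) + integral {t..t'} \<rho>)"
    by blast
  obtain \<eta>\<^sub>S where "\<eta>\<^sub>S > 0" and S_step: "\<And>t t'. 0 \<le> t \<Longrightarrow> t \<le> t' \<Longrightarrow> t' \<le> T \<Longrightarrow> t' - t < \<eta>\<^sub>S \<Longrightarrow>
      \<bar>S t' - S t - (t' - t) * k * S t - integral {t..t'} q\<bar> \<le> \<epsilon> / 2 * (t' - t)"
    using integral_solution_euler_step[OF sol \<open>0 \<le> T\<close>, of "\<epsilon> / 2"] \<open>\<epsilon> > 0\<close> by auto
  show ?thesis
  proof (rule that)
    show "min (min \<eta>\<^sub>N \<eta>\<^sub>S) (1 / (\<bar>k\<bar> + 1)) > 0"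
      using \<open>\<eta>\<^sub>N > 0\<close> \<open>\<eta>\<^sub>S > 0\<close> by simp
    fix t t' assume t: "0 \<le> t" "t \<le> t'" "t' \<le> T" "t' - t < min (min \<eta>\<^sub>N \<eta>\<^sub>S) (1 / (\<bar>k\<bar> + 1))"
    define h I where "h = t' - t" and "I = integral {t..t'} \<rho>"
    have "0 \<le> h" and "0 \<le> I"
      using t(2) integral_nonneg_everywhere[of \<rho>, OF assms(3)] by (simp_all add: h_def I_def)
    have "h < 1 / (\<bar>k\<bar> + 1)"
      using t(4) by (simp add: h_def)
    then have "\<bar>k\<bar> * h \<le> 1"
      using \<open>0 \<le> h\<close> by (simp add: field_simps)
    moreover have "\<bar>h * k\<bar> = \<bar>k\<bar> * h"
      using \<open>0 \<le> h\<close> by (simp add: abs_mult)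
    ultimately have "0 \<le> 1 + h * k" and "1 + h * k \<le> 1 + \<bar>k\<bar> * h"
      using abs_ge_self[of "h * k"] abs_ge_minus_self[of "h * k"] by simp_all
    have "N t' \<le> N t + h * k * N t + integral {t..t'} q + \<epsilon> / 2 * (h + I)"
      and "- (S t' - S t - h * k * S t - integral {t..t'} q) \<le> \<epsilon> / 2 * h"
      using N_step abs_le_D2[OF S_step[OF t(1-3)]] t by (auto simp: h_def I_def)
    moreover have "(1 + h * k) * (N t - S t) = N t + h * k * N t - (S t + h * k * S t)"
      and "\<epsilon> / 2 * (h + I) = \<epsilon> / 2 * h + \<epsilon> / 2 * I" and "\<epsilon> * (h + I) = \<epsilon> / 2 * h + \<epsilon> / 2 * h + \<epsilon> * I"
      by (simp_all add: algebra_simps)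
    moreover have "\<epsilon> / 2 * I \<le> \<epsilon> * I"
      using \<open>\<epsilon> > 0\<close> \<open>0 \<le> I\<close> by (simp add: mult_right_mono)
    ultimately have "N t' - S t' \<le> (1 + h * k) * (N t - S t) + \<epsilon> * (h + I)"
      by linarith
    also have "(1 + h * k) * (N t - S t) \<le> (1 + h * k) * max (N t - S t) 0"
      using \<open>0 \<le> 1 + h * k\<close> by (intro mult_left_mono) simp_all
    also have "\<dots> \<le> (1 + \<bar>k\<bar> * h) * max (N t - S t) 0"
      using \<open>1 + h * k \<le> 1 + \<bar>k\<bar> * h\<close> by (intro mult_right_mono) simp_all
    finally show "max (N t' - S t') 0 \<le> (1 + \<bar>k\<bar> * (t' - t)) * max (N t - S t) 0 + \<epsilon> * ((t' - t) + I)"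
      using \<open>0 \<le> h\<close> \<open>0 \<le> I\<close> \<open>\<epsilon> > 0\<close> by (simp add: h_def)
  qed
qed

text \<open>Gronwall's argument, applied to the excess max (N - S) 0.\<close>
lemma euler_subsolution_le_integral_solution:
  fixes N S q \<rho> :: "real \<Rightarrow> real"
  assumes "0 \<le> T" and "N 0 \<le> S 0"
    and sol: "integral_solution (\<lambda>\<tau>. k * S \<tau> + q \<tau>) S"
    and \<rho>: "\<rho> integrable_on {0..T}" "\<And>\<tau>. 0 \<le> \<rho> \<tau>"
    and sub: "euler_subsolution T k q \<rho> N"
  shows "N T \<le> S T"
proof -
  define R where "R t = integral {0..t} \<rho>" for t
  have R_diff: "R t' - R t = integral {t..t'} \<rho>" if "0 \<le> t" "t \<le> t'" "t' \<le> T" for t t'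
  proof -
    have "\<rho> integrable_on {0..t'}"
      using integrable_subinterval_real[OF \<rho>(1)] that by auto
    from Henstock_Kurzweil_Integration.integral_combine[OF that(1,2) this] show ?thesis
      by (simp add: R_def algebra_simps)
  qed
  have "max (N T - S T) 0 \<le> 0"
  proof (rule discrete_gronwall_nonpos[where P="\<lambda>t. max (N t - S t) 0" and K="\<bar>k\<bar>" and R=R])
    show "mono_on {0..T} R"
    proof (rule mono_onI)
      fix r r' assume "r \<in> {0..T}" "r' \<in> {0..T}" "r \<le> r'"
      then show "R r \<le> R r'"
        using R_diff[of r r'] integral_nonneg_everywhere[of \<rho>, OF \<rho>(2), of "{r..r'}"] by simp
    qed
    fix \<epsilon> :: real assume "\<epsilon> > 0"
    then obtain \<eta> where "\<eta> > 0" and step: "\<And>t t'. 0 \<le> t \<Longrightarrow> t \<le> t' \<Longrightarrow> t' \<le> T \<Longrightarrow> t' - t < \<eta> \<Longrightarrow>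
        max (N t' - S t') 0 \<le> (1 + \<bar>k\<bar> * (t' - t)) * max (N t - S t) 0 + \<epsilon> * ((t' - t) + integral {t..t'} \<rho>)"
      using euler_subsolution_excess_step[OF \<open>0 \<le> T\<close> sol \<rho>(2) sub] by blast
    then show "\<exists>\<eta>>0. \<forall>t t'. 0 \<le> t \<longrightarrow> t \<le> t' \<longrightarrow> t' \<le> T \<longrightarrow> t' - t < \<eta> \<longrightarrow>
        max (N t' - S t') 0 \<le> (1 + \<bar>k\<bar> * (t' - t)) * max (N t - S t) 0 + \<epsilon> * ((t' - t) + (R t' - R t))"
      using R_diff by auto
  qed (use \<open>0 \<le> T\<close> \<open>N 0 \<le> S 0\<close> in auto)
  then show ?thesis by simp
qed

section \<open>The two error estimates\<close>

locale ssm_prediction =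
  fixes Ar :: "real^('r::{finite,linorder})^('r::{finite,linorder})" and An :: "real^('c::{finite,linorder})^('c::{finite,linorder})"
    and Br :: "real^('m::finite)^('r::{finite,linorder})" and Bn :: "real^'m^('c::{finite,linorder})"
    and fnl :: "(real^('r::{finite,linorder})) \<times> (real^('c::{finite,linorder})) \<Rightarrow> (real^('r::{finite,linorder})) \<times> (real^('c::{finite,linorder}))"
    and wnl :: "real^('r::{finite,linorder}) \<Rightarrow> (real^('r::{finite,linorder})) \<times> (real^('c::{finite,linorder}))"
    and wnl' :: "real^('r::{finite,linorder}) \<Rightarrow> ((real^('r::{finite,linorder})) \<Rightarrow>\<^sub>L ((real^('r::{finite,linorder})) \<times> (real^('c::{finite,linorder}))))"
    and g :: "real^('r::{finite,linorder}) \<Rightarrow> real^('r::{finite,linorder})"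
    and Lf Lw Lr dbar :: real
    and u :: "real \<Rightarrow> real^'m" and d :: "real \<Rightarrow> (real^('r::{finite,linorder})) \<times> (real^('c::{finite,linorder}))"
    and x :: "real \<Rightarrow> (real^('r::{finite,linorder})) \<times> (real^('c::{finite,linorder}))" and zr :: "real \<Rightarrow> real^('r::{finite,linorder})"
    and s \<delta> :: "real \<Rightarrow> real"
  assumes A_block_r: "real_block_diag Ar" and A_block_n: "real_block_diag An"
    and f_zero: "fnl 0 = 0"
    and f_lip: "Lf-lipschitz_on UNIV fnl"
    and w_deriv: "\<forall>xr. (wnl has_derivative blinfun_apply (wnl' xr)) (at xr)"
    and w_C1: "continuous_on UNIV wnl'"
    and w_lip: "Lw-lipschitz_on UNIV wnl"
    and W_inv: "\<forall>xr. fst ((xr, 0) + wnl xr) = xr"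
    and W_invariant: "\<forall>xr. (Ar *v fst ((xr, 0) + wnl xr), An *v snd ((xr, 0) + wnl xr))
                          + fnl ((xr, 0) + wnl xr)
                        = (g xr, 0) + blinfun_apply (wnl' xr) (g xr)"
    and r_lip: "Lr-lipschitz_on UNIV (\<lambda>xr. fst (fnl ((xr, 0) + wnl xr)))"
    and u_loc_int: "\<forall>T\<ge>0. u absolutely_integrable_on {0..T}"
    and d_bound: "\<forall>t\<ge>0. norm (d t) \<le> dbar"
    and x_sol: "integral_solution
      (\<lambda>\<tau>. (Ar *v fst (x \<tau>), An *v snd (x \<tau>)) + fnl (x \<tau>) + (Br *v u \<tau>, Bn *v u \<tau>) + d \<tau>) x"
    and z_sol: "integral_solution (\<lambda>\<tau>. Ar *v zr \<tau> + fst (fnl ((zr \<tau>, 0) + wnl (zr \<tau>))) + Br *v u \<tau>) zr"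
    and s_sol: "integral_solution (\<lambda>\<tau>. max_re_eig An * s \<tau> + (1 + Lw) * (Lf * s \<tau> + dbar)
      + norm (Bn *v u \<tau>) + Lw * norm (Br *v u \<tau>)) s"
    and \<delta>_sol: "integral_solution (\<lambda>\<tau>. (max_re_eig Ar + Lr) * \<delta> \<tau> + Lf * s \<tau> + dbar) \<delta>"
    and init_n: "norm (snd (x 0) - snd (wnl (fst (x 0)))) \<le> s 0"
    and init_r: "norm (fst (x 0) - zr 0) \<le> \<delta> 0"
begin

text \<open>States are pairs (x_r, x_n), so V_r^T and V_n^T are fst and snd; normal_dev is the
  paper's x_n tilde and pred_err is x_r - z_r.\<close>
definition "x_rhs \<tau> = (Ar *v fst (x \<tau>), An *v snd (x \<tau>)) + fnl (x \<tau>) + (Br *v u \<tau>, Bn *v u \<tau>) + d \<tau>"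
definition "rnl a = fst (fnl ((a, 0) + wnl a))"
definition "z_rhs \<tau> = Ar *v zr \<tau> + rnl (zr \<tau>) + Br *v u \<tau>"
definition "normal_dev t = snd (x t) - snd (wnl (fst (x t)))"
definition "pred_err t = fst (x t) - zr t"

lemma lipschitz_constants_nonneg: "0 \<le> Lf" "0 \<le> Lw" "0 \<le> Lr"
  using f_lip w_lip r_lip by (simp_all add: lipschitz_on_def)

lemma dbar_nonneg: "0 \<le> dbar"
  using d_bound norm_ge_zero order_trans by blast

lemma fst_wnl [simp]: "fst (wnl a) = 0"
  using W_inv by simp

lemma manifold_point_eq: "(a, 0) + wnl a = (a, snd (wnl a))"
  by (simp add: prod_eq_iff)

lemma fst_wnl' [simp]: "fst (wnl' a v) = 0"
proof -
  have "((\<lambda>y. fst (wnl y)) has_derivative (\<lambda>v. fst (wnl' a v))) (at a)"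
    using has_derivative_fst[OF w_deriv[rule_format, of a]] .
  moreover have "((\<lambda>y. fst (wnl y)) has_derivative (\<lambda>v. 0)) (at a)"
    by simp
  ultimately show ?thesis
    using has_derivative_unique by metis
qed

lemma norm_wnl'_le: "norm (wnl' a v) \<le> Lw * norm v"
  using has_derivative_norm_le_lipschitz[OF w_deriv[rule_format] w_lip] .

lemma reduced_dynamics: "g a = Ar *v a + rnl a"
  using arg_cong[OF W_invariant[rule_format, of a], of fst] by (simp add: rnl_def)

lemma invariance_normal:
  "snd (wnl' a (g a)) = An *v snd (wnl a) + snd (fnl (a, snd (wnl a)))"
  using arg_cong[OF W_invariant[rule_format, of a], of snd] by (simp add: manifold_point_eq)

lemma norm_fnl_diff_le: "norm (fnl p - fnl q) \<le> Lf * norm (p - q)"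
  using f_lip unfolding lipschitz_on_def dist_norm by blast

lemma norm_rnl_diff_le: "norm (rnl a - rnl b) \<le> Lr * norm (a - b)"
  using r_lip by (simp add: lipschitz_on_def dist_norm rnl_def)

lemma x_integral_solution: "integral_solution x_rhs x"
  using x_sol unfolding x_rhs_def[abs_def] .

lemma zr_integral_solution: "integral_solution z_rhs zr"
  using z_sol unfolding z_rhs_def[abs_def] rnl_def .

lemma norm_u_integrable: "0 \<le> T \<Longrightarrow> (\<lambda>\<tau>. norm (u \<tau>)) integrable_on {0..T}"
  using u_loc_int by (simp add: absolutely_integrable_on_def)

lemma normal_dev_continuous_on: "0 \<le> T \<Longrightarrow> continuous_on {0..T} normal_dev"
proof -
  assume "0 \<le> T"
  have "continuous_on {0..T} (\<lambda>t. fst (x t))"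
    using integral_solution_continuous_on[OF x_integral_solution \<open>0 \<le> T\<close>] by (rule continuous_on_fst)
  with lipschitz_on_continuous_on[OF w_lip] have "continuous_on {0..T} (\<lambda>t. wnl (fst (x t)))"
    by (rule continuous_on_compose2) simp
  then show ?thesis
    unfolding normal_dev_def[abs_def]
    using integral_solution_continuous_on[OF x_integral_solution \<open>0 \<le> T\<close>]
    by (intro continuous_intros)
qed

lemma pred_err_continuous_on: "0 \<le> T \<Longrightarrow> continuous_on {0..T} pred_err"
  unfolding pred_err_def[abs_def]
  using integral_solution_continuous_on[OF x_integral_solution]
    integral_solution_continuous_on[OF zr_integral_solution]
  by (intro continuous_intros)

lemma norm_fnl_sub_manifold_le:
  "norm (fnl p - fnl (fst (x t), snd (wnl (fst (x t))))) \<le> Lf * norm (p - x t) + Lf * norm (normal_dev t)"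
proof -
  let ?W = "(fst (x t), snd (wnl (fst (x t))))"
  have "x t - ?W = (0, normal_dev t)"
    by (simp add: normal_dev_def prod_eq_iff)
  then have "norm (x t - ?W) = norm (normal_dev t)"
    by (simp add: norm_Pair)
  moreover have "norm (p - ?W) \<le> norm (p - x t) + norm (x t - ?W)"
    by (rule norm_diff_triangle_le[where y="x t"]) simp_all
  ultimately have "norm (p - ?W) \<le> norm (p - x t) + norm (normal_dev t)"
    by simp
  then have "Lf * norm (p - ?W) \<le> Lf * (norm (p - x t) + norm (normal_dev t))"
    using lipschitz_constants_nonneg(1) by (rule mult_left_mono)
  then show ?thesis
    using norm_fnl_diff_le[of p ?W] by (simp add: algebra_simps)
qed

definition "w_rem a y = wnl y - wnl a - wnl' a (y - a)"

definition "normal_defect t \<tau> = snd (x_rhs \<tau>) - snd (wnl' (fst (x t)) (fst (x_rhs \<tau>))) - An *v normal_dev t"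

definition "q_n \<tau> = (1 + Lw) * dbar + norm (Bn *v u \<tau>) + Lw * norm (Br *v u \<tau>)"

definition "k_n = max_re_eig An + (1 + Lw) * Lf"

definition "c_n = onorm ((*v) An) + Lf + Lw * onorm ((*v) Ar) + Lw * Lf"

lemma s_integral_solution: "integral_solution (\<lambda>\<tau>. k_n * s \<tau> + q_n \<tau>) s"
  using s_sol by (simp add: k_n_def q_n_def algebra_simps)

lemma normal_dev_increment:
  assumes "0 \<le> t" and "t \<le> t'"
  shows "(normal_defect t has_integral normal_dev t' - normal_dev t - (t' - t) *\<^sub>R (An *v normal_dev t)
    + snd (w_rem (fst (x t)) (fst (x t')))) {t..t'}"
proof -
  let ?a = "fst (x t)"
  have incr: "(x_rhs has_integral (x t' - x t)) {t..t'}"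
    using integral_solution_increment[OF x_integral_solution assms] .
  have lin: "bounded_linear (\<lambda>z. snd (wnl' ?a (fst z)))"
    by (intro bounded_linear_compose[OF bounded_linear_snd]
        bounded_linear_compose[OF blinfun.bounded_linear_right] bounded_linear_fst)
  have "((\<lambda>\<tau>. snd (x_rhs \<tau>) - snd (wnl' ?a (fst (x_rhs \<tau>))) - An *v normal_dev t)
      has_integral snd (x t' - x t) - snd (wnl' ?a (fst (x t' - x t))) - (t' - t) *\<^sub>R (An *v normal_dev t))
      {t..t'}"
    using has_integral_linear[OF incr bounded_linear_snd] has_integral_linear[OF incr lin]
      has_integral_const_real[of "An *v normal_dev t" t t'] assms(2)
    by (intro has_integral_diff) (auto simp: o_def)
  then show ?thesis
    by (simp add: normal_defect_def[abs_def] normal_dev_def w_rem_def blinfun.diff_right algebra_simps)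
qed

lemma normal_defect_eq:
  fixes t \<tau> :: real
  defines "a \<equiv> fst (x t)" and "\<Delta> \<equiv> x \<tau> - x t"
  defines "df \<equiv> fnl (x \<tau>) - fnl (a, snd (wnl a))"
  defines "v \<equiv> Ar *v fst \<Delta> + fst df + Br *v u \<tau> + fst (d \<tau>)"
  shows "normal_defect t \<tau> = An *v snd \<Delta> + snd df + Bn *v u \<tau> + snd (d \<tau>) - snd (wnl' a v)"
proof -
  have "fst (x_rhs \<tau>) = g a + v"
    unfolding reduced_dynamics rnl_def manifold_point_eq
    by (simp add: x_rhs_def v_def df_def \<Delta>_def a_def matrix_vector_right_distrib algebra_simps)
  then have "snd (wnl' a (fst (x_rhs \<tau>))) = An *v snd (wnl a) + snd (fnl (a, snd (wnl a))) + snd (wnl' a v)"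
    by (simp add: blinfun.add_right invariance_normal)
  then show ?thesis
    by (simp add: normal_defect_def x_rhs_def normal_dev_def \<Delta>_def df_def a_def
        matrix_vector_mult_diff_distrib algebra_simps)
qed

lemma c_n_nonneg: "0 \<le> c_n"
  unfolding c_n_def using onorm_mult_vec_nonneg[of An] onorm_mult_vec_nonneg[of Ar] lipschitz_constants_nonneg
  by (intro add_nonneg_nonneg mult_nonneg_nonneg) auto

lemma norm_normal_defect_le:
  assumes "0 \<le> \<tau>"
  shows "norm (normal_defect t \<tau>) \<le> c_n * norm (x \<tau> - x t) + (1 + Lw) * Lf * norm (normal_dev t) + q_n \<tau>"
proof -
  define CAr CAn where "CAr = onorm ((*v) Ar)" and "CAn = onorm ((*v) An)"
  note nonneg = onorm_mult_vec_nonneg[of Ar, folded CAr_def] onorm_mult_vec_nonneg[of An, folded CAn_def]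
    lipschitz_constants_nonneg
  define a \<Delta> N where "a = fst (x t)" and "\<Delta> = x \<tau> - x t" and "N = norm (normal_dev t)"
  define df where "df = fnl (x \<tau>) - fnl (a, snd (wnl a))"
  define v where "v = Ar *v fst \<Delta> + fst df + Br *v u \<tau> + fst (d \<tau>)"
  have df: "norm (fst df) \<le> Lf * norm \<Delta> + Lf * N" "norm (snd df) \<le> Lf * norm \<Delta> + Lf * N"
    using norm_fnl_sub_manifold_le[of "x \<tau>" t] norm_fst_le_norm[of df] norm_snd_le_norm[of df]
    unfolding df_def a_def \<Delta>_def N_def by linarith+
  have d: "norm (fst (d \<tau>)) \<le> dbar" "norm (snd (d \<tau>)) \<le> dbar"
    using d_bound \<open>0 \<le> \<tau>\<close> norm_fst_le_norm[of "d \<tau>"] norm_snd_le_norm[of "d \<tau>"] by force+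
  have \<Delta>: "norm (Ar *v fst \<Delta>) \<le> CAr * norm \<Delta>" "norm (An *v snd \<Delta>) \<le> CAn * norm \<Delta>"
    using norm_mult_vec_le_onorm[of Ar "fst \<Delta>", folded CAr_def] norm_mult_vec_le_onorm[of An "snd \<Delta>", folded CAn_def]
      mult_left_mono[OF norm_fst_le_norm[of \<Delta>], of CAr] mult_left_mono[OF norm_snd_le_norm[of \<Delta>], of CAn] nonneg
    by linarith+
  have "norm v \<le> norm (Ar *v fst \<Delta>) + norm (fst df) + norm (Br *v u \<tau>) + norm (fst (d \<tau>))"
    unfolding v_def by (intro order_trans[OF norm_triangle_ineq] add_mono order_refl)
  then have "norm v \<le> CAr * norm \<Delta> + (Lf * norm \<Delta> + Lf * N) + norm (Br *v u \<tau>) + dbar"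
    using \<Delta> df d by linarith
  then have "norm (snd (wnl' a v)) \<le> Lw * (CAr * norm \<Delta> + (Lf * norm \<Delta> + Lf * N) + norm (Br *v u \<tau>) + dbar)"
    using norm_snd_le_norm[of "wnl' a v"] norm_wnl'_le[of a v] mult_left_mono[OF _ nonneg(4)] by fastforce
  moreover have "norm (normal_defect t \<tau>) \<le> norm (An *v snd \<Delta>) + norm (snd df) + norm (Bn *v u \<tau>)
      + norm (snd (d \<tau>)) + norm (snd (wnl' a v))"
    unfolding normal_defect_eq a_def[symmetric] \<Delta>_def[symmetric] df_def[symmetric] v_def[symmetric]
    by (intro order_trans[OF norm_triangle_ineq4] add_mono order_trans[OF norm_triangle_ineq] order_refl)
  ultimately have "norm (normal_defect t \<tau>) \<le> CAn * norm \<Delta> + (Lf * norm \<Delta> + Lf * N) + norm (Bn *v u \<tau>) + dbar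
      + Lw * (CAr * norm \<Delta> + (Lf * norm \<Delta> + Lf * N) + norm (Br *v u \<tau>) + dbar)"
    using \<Delta> df d by linarith
  then show ?thesis
    by (simp add: c_n_def CAr_def CAn_def q_n_def \<Delta>_def N_def algebra_simps)
qed

lemma norm_x_increment_le:
  assumes "0 \<le> T"
  obtains M C where "0 \<le> M" and "0 \<le> C" and "\<And>t t'. 0 \<le> t \<Longrightarrow> t \<le> t' \<Longrightarrow> t' \<le> T \<Longrightarrow>
    norm (x t' - x t) \<le> (t' - t) * M + C * integral {t..t'} (\<lambda>\<tau>. norm (u \<tau>))"
proof -
  define CAr CAn CBr CBn
    where "CAr = onorm ((*v) Ar)" and "CAn = onorm ((*v) An)"
      and "CBr = onorm ((*v) Br)" and "CBn = onorm ((*v) Bn)"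
  note nonneg = onorm_mult_vec_nonneg[of Ar, folded CAr_def] onorm_mult_vec_nonneg[of An, folded CAn_def]
    onorm_mult_vec_nonneg[of Br, folded CBr_def] onorm_mult_vec_nonneg[of Bn, folded CBn_def]
    lipschitz_constants_nonneg dbar_nonneg
  obtain Mx where "0 \<le> Mx" and Mx: "\<And>\<tau>. \<tau> \<in> {0..T} \<Longrightarrow> norm (x \<tau>) \<le> Mx"
    using continuous_on_Icc_norm_bound[OF integral_solution_continuous_on[OF x_integral_solution \<open>0 \<le> T\<close>]]
    by blast
  have rhs: "norm (x_rhs \<tau>) \<le> ((CAr + CAn + Lf) * Mx + dbar) + (CBr + CBn) * norm (u \<tau>)"
    if "\<tau> \<in> {0..T}" for \<tau>
  proof -
    have "norm (Ar *v fst (x \<tau>), An *v snd (x \<tau>)) \<le> CAr * Mx + CAn * Mx"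
      using norm_Pair_le[of "Ar *v fst (x \<tau>)" "An *v snd (x \<tau>)"]
        norm_mult_vec_le_onorm[of Ar "fst (x \<tau>)", folded CAr_def] norm_mult_vec_le_onorm[of An "snd (x \<tau>)", folded CAn_def]
        mult_left_mono[OF order_trans[OF norm_fst_le_norm Mx[OF that]] nonneg(1)]
        mult_left_mono[OF order_trans[OF norm_snd_le_norm Mx[OF that]] nonneg(2)]
      by linarith
    moreover have "norm (fnl (x \<tau>)) \<le> Lf * Mx"
      using norm_fnl_diff_le[of "x \<tau>" 0] mult_left_mono[OF Mx[OF that] nonneg(5)] by (simp add: f_zero)
    moreover have "norm (Br *v u \<tau>, Bn *v u \<tau>) \<le> (CBr + CBn) * norm (u \<tau>)"
      using norm_Pair_le[of "Br *v u \<tau>" "Bn *v u \<tau>"] norm_mult_vec_le_onorm[of Br "u \<tau>", folded CBr_def]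
        norm_mult_vec_le_onorm[of Bn "u \<tau>", folded CBn_def] by (simp add: algebra_simps)
    moreover have "norm (d \<tau>) \<le> dbar"
      using d_bound that by simp
    moreover have "norm (x_rhs \<tau>) \<le> norm (Ar *v fst (x \<tau>), An *v snd (x \<tau>)) + norm (fnl (x \<tau>))
        + norm (Br *v u \<tau>, Bn *v u \<tau>) + norm (d \<tau>)"
      unfolding x_rhs_def by (intro order_trans[OF norm_triangle_ineq] add_mono order_refl)
    ultimately show ?thesis
      by (simp add: algebra_simps)
  qed
  show ?thesis
  proof (rule that)
    show "0 \<le> (CAr + CAn + Lf) * Mx + dbar" and "0 \<le> CBr + CBn"
      using nonneg \<open>0 \<le> Mx\<close> by simp_all
    fix t t' assume "0 \<le> t" "t \<le> t'" "t' \<le> T"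
    have "(\<lambda>\<tau>. (CBr + CBn) * norm (u \<tau>)) integrable_on {t..t'}"
      using integrable_subinterval_real[OF norm_u_integrable[OF \<open>0 \<le> T\<close>], of t t'] \<open>0 \<le> t\<close> \<open>t' \<le> T\<close>
      by (intro integrable_cmul[where 'b=real, simplified]) simp
    then have "norm (x t' - x t) \<le> (t' - t) * ((CAr + CAn + Lf) * Mx + dbar)
        + integral {t..t'} (\<lambda>\<tau>. (CBr + CBn) * norm (u \<tau>))"
      using \<open>0 \<le> t\<close> \<open>t \<le> t'\<close> \<open>t' \<le> T\<close>
      by (intro norm_has_integral_le_affine[OF integral_solution_increment[OF x_integral_solution]] rhs)
        auto
    then show "norm (x t' - x t) \<le> (t' - t) * ((CAr + CAn + Lf) * Mx + dbar)
        + (CBr + CBn) * integral {t..t'} (\<lambda>\<tau>. norm (u \<tau>))"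
      by simp
  qed
qed

lemma q_n_integrable: "0 \<le> t \<Longrightarrow> t \<le> t' \<Longrightarrow> q_n integrable_on {t..t'}"
  using integrable_subinterval_real[OF integral_solution_affine_integrable[OF s_integral_solution, of t']]
  by simp

lemma norm_normal_dev_step_le:
  assumes "0 \<le> t" and "t \<le> t'"
    and "(t' - t) * \<bar>max_re_eig An\<bar> \<le> 1/2" and "(t' - t) * (onorm ((*v) An))\<^sup>2 * norm (normal_dev t) \<le> e"
    and close: "\<And>\<tau>. \<tau> \<in> {t..t'} \<Longrightarrow> norm (x \<tau> - x t) \<le> e"
    and rem: "norm (w_rem (fst (x t)) (fst (x t'))) \<le> e * norm (x t' - x t)"
  shows "norm (normal_dev t') \<le> norm (normal_dev t) + (t' - t) * k_n * norm (normal_dev t)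
    + integral {t..t'} q_n + e * ((t' - t) * (1 + c_n) + norm (x t' - x t))"
proof -
  define h N where "h = t' - t" and "N = norm (normal_dev t)"
  define I where "I = normal_dev t' - normal_dev t - h *\<^sub>R (An *v normal_dev t) + snd (w_rem (fst (x t)) (fst (x t')))"
  have euler: "norm (normal_dev t + h *\<^sub>R (An *v normal_dev t)) \<le> (1 + h * max_re_eig An) * N + e * h"
    unfolding N_def using assms(2-4)
    by (intro norm_euler_step_le_eps real_block_diag_inner_le_max_re_eig[OF A_block_n])
      (simp_all add: h_def norm_mult_vec_le_onorm)
  have "norm I \<le> h * (c_n * e + (1 + Lw) * Lf * N) + integral {t..t'} q_n"
  proof (unfold h_def, rule norm_has_integral_le_affine)
    show "(normal_defect t has_integral I) {t..t'}"
      unfolding I_def h_def using normal_dev_increment[OF assms(1,2)] .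
    fix \<tau> assume "\<tau> \<in> {t..t'}"
    then have "c_n * norm (x \<tau> - x t) \<le> c_n * e"
      using close c_n_nonneg by (intro mult_left_mono) auto
    then show "norm (normal_defect t \<tau>) \<le> c_n * e + (1 + Lw) * Lf * N + q_n \<tau>"
      using norm_normal_defect_le[of \<tau> t] \<open>\<tau> \<in> {t..t'}\<close> \<open>0 \<le> t\<close> by (simp add: N_def)
  qed (use assms(1,2) q_n_integrable in auto)
  moreover have "norm (snd (w_rem (fst (x t)) (fst (x t')))) \<le> e * norm (x t' - x t)"
    using order_trans[OF norm_snd_le_norm rem] .
  moreover have "norm (normal_dev t') \<le> norm (normal_dev t + h *\<^sub>R (An *v normal_dev t)) + norm I
      + norm (snd (w_rem (fst (x t)) (fst (x t'))))"
  proof -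
    let ?a = "normal_dev t + h *\<^sub>R (An *v normal_dev t)" and ?r = "snd (w_rem (fst (x t)) (fst (x t')))"
    have "norm (normal_dev t') = norm (?a + I - ?r)"
      by (simp add: I_def)
    then show ?thesis
      using norm_triangle_ineq4[of "?a + I" ?r] norm_triangle_ineq[of ?a I] by linarith
  qed
  ultimately have "norm (normal_dev t') \<le> (1 + h * max_re_eig An) * N + e * h
      + (h * (c_n * e + (1 + Lw) * Lf * N) + integral {t..t'} q_n) + e * norm (x t' - x t)"
    using euler by linarith
  then show ?thesis
    by (simp add: h_def N_def k_n_def algebra_simps)
qed

lemma x_short_step_bounds:
  assumes "0 \<le> T" and "\<epsilon> > 0"
  obtains \<eta> where "\<eta> > 0" and "\<And>t t'. 0 \<le> t \<Longrightarrow> t \<le> t' \<Longrightarrow> t' \<le> T \<Longrightarrow> t' - t < \<eta> \<Longrightarrow>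
    (\<forall>\<tau>\<in>{t..t'}. norm (x \<tau> - x t) \<le> \<epsilon>) \<and> norm (w_rem (fst (x t)) (fst (x t'))) \<le> \<epsilon> * norm (x t' - x t)"
proof -
  note x_cont = integral_solution_continuous_on[OF x_integral_solution \<open>0 \<le> T\<close>]
  obtain Mx where Mx: "\<And>t. t \<in> {0..T} \<Longrightarrow> norm (x t) \<le> Mx"
    using continuous_on_Icc_norm_bound[OF x_cont] by blast
  obtain \<delta> where "\<delta> > 0" and remainder: "\<And>a y. norm a \<le> Mx \<Longrightarrow> norm (y - a) < \<delta> \<Longrightarrow>
      norm (w_rem a y) \<le> \<epsilon> * norm (y - a)"
    using continuous_derivative_uniform_remainder[OF w_deriv w_C1 \<open>\<epsilon> > 0\<close>, where M=Mx]
    unfolding w_rem_def by blast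
  have "min \<epsilon> \<delta> > 0"
    using \<open>\<epsilon> > 0\<close> \<open>\<delta> > 0\<close> by simp
  then obtain \<eta> where "\<eta> > 0" and modulus: "\<And>\<tau> t. \<tau> \<in> {0..T} \<Longrightarrow> t \<in> {0..T} \<Longrightarrow> \<bar>t - \<tau>\<bar> < \<eta> \<Longrightarrow>
      dist (x t) (x \<tau>) < min \<epsilon> \<delta>"
    using continuous_on_Icc_uniform_modulus[OF x_cont] by blast
  show ?thesis
  proof (rule that[OF \<open>\<eta> > 0\<close>])
    fix t t' assume t: "0 \<le> t" "t \<le> t'" "t' \<le> T" "t' - t < \<eta>"
    then have close: "norm (x \<tau> - x t) \<le> \<epsilon>" "norm (x \<tau> - x t) < \<delta>" if "\<tau> \<in> {t..t'}" for \<tau>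
      using modulus[of t \<tau>] that by (auto simp: dist_norm)
    have "norm (fst (x t)) \<le> Mx"
      using order_trans[OF norm_fst_le_norm Mx] t by simp
    moreover have "norm (fst (x t') - fst (x t)) \<le> norm (x t' - x t)"
      using norm_fst_le_norm[of "x t' - x t"] by simp
    ultimately have "norm (w_rem (fst (x t)) (fst (x t'))) \<le> \<epsilon> * norm (fst (x t') - fst (x t))"
      using remainder close(2)[of t'] t by force
    also have "\<dots> \<le> \<epsilon> * norm (x t' - x t)"
      using norm_fst_le_norm[of "x t' - x t"] \<open>\<epsilon> > 0\<close> by (intro mult_left_mono) simp_all
    finally show "(\<forall>\<tau>\<in>{t..t'}. norm (x \<tau> - x t) \<le> \<epsilon>)
        \<and> norm (w_rem (fst (x t)) (fst (x t'))) \<le> \<epsilon> * norm (x t' - x t)"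
      using close(1) by blast
  qed
qed

lemma normal_dev_euler_subsolution:
  assumes "0 \<le> T"
  shows "euler_subsolution T k_n q_n (\<lambda>\<tau>. norm (u \<tau>)) (\<lambda>t. norm (normal_dev t))"
proof -
  obtain M C where "0 \<le> M" "0 \<le> C" and increment: "\<And>t t'. 0 \<le> t \<Longrightarrow> t \<le> t' \<Longrightarrow> t' \<le> T \<Longrightarrow>
      norm (x t' - x t) \<le> (t' - t) * M + C * integral {t..t'} (\<lambda>\<tau>. norm (u \<tau>))"
    using norm_x_increment_le[OF \<open>0 \<le> T\<close>] by blast
  obtain M\<xi> where "0 \<le> M\<xi>" and M\<xi>: "\<And>t. t \<in> {0..T} \<Longrightarrow> norm (normal_dev t) \<le> M\<xi>"
    using continuous_on_Icc_norm_bound[OF normal_dev_continuous_on[OF \<open>0 \<le> T\<close>]] by blast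
  show ?thesis
  proof (rule euler_subsolutionI[where C="1 + c_n + M + C"])
    show "0 \<le> 1 + c_n + M + C"
      using c_n_nonneg \<open>0 \<le> M\<close> \<open>0 \<le> C\<close> by simp
    fix \<epsilon> :: real assume "\<epsilon> > 0"
    obtain \<eta>\<^sub>x where "\<eta>\<^sub>x > 0" and x_step: "\<And>t t'. 0 \<le> t \<Longrightarrow> t \<le> t' \<Longrightarrow> t' \<le> T \<Longrightarrow> t' - t < \<eta>\<^sub>x \<Longrightarrow>
        (\<forall>\<tau>\<in>{t..t'}. norm (x \<tau> - x t) \<le> \<epsilon>) \<and> norm (w_rem (fst (x t)) (fst (x t'))) \<le> \<epsilon> * norm (x t' - x t)"
      using x_short_step_bounds[OF \<open>0 \<le> T\<close> \<open>\<epsilon> > 0\<close>] by blast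
    obtain \<eta>\<^sub>E where "\<eta>\<^sub>E > 0" and euler: "\<And>h a. 0 \<le> h \<Longrightarrow> h < \<eta>\<^sub>E \<Longrightarrow> a \<le> M\<xi> \<Longrightarrow>
        h * \<bar>max_re_eig An\<bar> \<le> 1/2 \<and> h * (onorm ((*v) An))\<^sup>2 * a \<le> \<epsilon>"
      using euler_step_size[OF \<open>0 \<le> M\<xi>\<close> \<open>\<epsilon> > 0\<close>] by blast
    show "\<exists>\<eta>>0. \<forall>t t'. 0 \<le> t \<longrightarrow> t \<le> t' \<longrightarrow> t' \<le> T \<longrightarrow> t' - t < \<eta> \<longrightarrow>
      norm (normal_dev t') \<le> norm (normal_dev t) + (t' - t) * k_n * norm (normal_dev t) + integral {t..t'} q_n
        + (1 + c_n + M + C) * \<epsilon> * ((t' - t) + integral {t..t'} (\<lambda>\<tau>. norm (u \<tau>)))"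
    proof (intro exI[of _ "min \<eta>\<^sub>x \<eta>\<^sub>E"] conjI allI impI)
      show "min \<eta>\<^sub>x \<eta>\<^sub>E > 0"
        using \<open>\<eta>\<^sub>x > 0\<close> \<open>\<eta>\<^sub>E > 0\<close> by simp
      fix t t' assume t: "0 \<le> t" "t \<le> t'" "t' \<le> T" "t' - t < min \<eta>\<^sub>x \<eta>\<^sub>E"
      define U where "U = integral {t..t'} (\<lambda>\<tau>. norm (u \<tau>))"
      have "norm (normal_dev t') \<le> norm (normal_dev t) + (t' - t) * k_n * norm (normal_dev t)
          + integral {t..t'} q_n + \<epsilon> * ((t' - t) * (1 + c_n) + norm (x t' - x t))"
        using x_step[OF t(1-3)] euler[of "t' - t" "norm (normal_dev t)"] M\<xi>[of t] t
        by (intro norm_normal_dev_step_le) auto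
      also have "\<epsilon> * ((t' - t) * (1 + c_n) + norm (x t' - x t))
          \<le> \<epsilon> * ((t' - t) * (1 + c_n) + ((t' - t) * M + C * U))"
        using increment[OF t(1-3)] \<open>\<epsilon> > 0\<close> by (simp add: U_def)
      also have "\<dots> \<le> (1 + c_n + M + C) * \<epsilon> * ((t' - t) + U)"
        using t(2) \<open>\<epsilon> > 0\<close> \<open>0 \<le> M\<close> \<open>0 \<le> C\<close> c_n_nonneg integral_nonneg_everywhere[of "\<lambda>\<tau>. norm (u \<tau>)"]
        by (simp add: U_def algebra_simps mult_left_mono add_mono)
      finally show "norm (normal_dev t') \<le> norm (normal_dev t) + (t' - t) * k_n * norm (normal_dev t)
          + integral {t..t'} q_n + (1 + c_n + M + C) * \<epsilon> * ((t' - t) + U)"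
        by simp
    qed
  qed simp
qed

lemma norm_normal_dev_le:
  assumes "0 \<le> t"
  shows "norm (normal_dev t) \<le> s t"
proof (rule euler_subsolution_le_integral_solution[where N="\<lambda>t. norm (normal_dev t)" and \<rho>="\<lambda>\<tau>. norm (u \<tau>)",
      OF assms _ s_integral_solution norm_u_integrable[OF assms] _ normal_dev_euler_subsolution[OF assms]])
  show "norm (normal_dev 0) \<le> s 0"
    using init_n by (simp add: normal_dev_def)
qed simp

definition "pred_defect t \<tau> = fst (x_rhs \<tau>) - z_rhs \<tau> - Ar *v pred_err t"

definition "k_r = max_re_eig Ar + Lr"

definition "q_r \<tau> = Lf * s \<tau> + dbar"

definition "c_r = onorm ((*v) Ar) + Lf + Lf + Lr"

lemma c_r_nonneg: "0 \<le> c_r"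
  using onorm_mult_vec_nonneg[of Ar] lipschitz_constants_nonneg by (simp add: c_r_def)

lemma \<delta>_integral_solution: "integral_solution (\<lambda>\<tau>. k_r * \<delta> \<tau> + q_r \<tau>) \<delta>"
  using \<delta>_sol by (simp add: k_r_def q_r_def algebra_simps)

lemma pred_err_increment:
  assumes "0 \<le> t" and "t \<le> t'"
  shows "(pred_defect t has_integral pred_err t' - pred_err t - (t' - t) *\<^sub>R (Ar *v pred_err t)) {t..t'}"
proof -
  have "((\<lambda>\<tau>. fst (x_rhs \<tau>)) has_integral fst (x t' - x t)) {t..t'}"
    using has_integral_linear[OF integral_solution_increment[OF x_integral_solution assms] bounded_linear_fst]
    by (simp add: o_def)
  from has_integral_diff[OF has_integral_diff[OF this integral_solution_increment[OF zr_integral_solution assms]]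
      has_integral_const_real[of "Ar *v pred_err t" t t']]
  have "(pred_defect t has_integral fst (x t' - x t) - (zr t' - zr t) - (t' - t) *\<^sub>R (Ar *v pred_err t)) {t..t'}"
    unfolding pred_defect_def[abs_def] using assms(2) by simp
  moreover have "fst (x t' - x t) - (zr t' - zr t) = pred_err t' - pred_err t"
    by (simp add: pred_err_def)
  ultimately show ?thesis by simp
qed

lemma norm_pred_defect_le:
  assumes "0 \<le> \<tau>"
  shows "norm (pred_defect t \<tau>) \<le> onorm ((*v) Ar) * norm (pred_err \<tau> - pred_err t)
    + Lf * norm (x \<tau> - x t) + Lf * norm (normal_dev t) + Lr * norm (pred_err t) + Lr * norm (zr \<tau> - zr t) + dbar"
proof -
  define a where "a = fst (x t)"
  have "pred_defect t \<tau> = Ar *v (pred_err \<tau> - pred_err t) + (fst (fnl (x \<tau>)) - rnl (zr \<tau>)) + fst (d \<tau>)"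
    by (simp add: pred_defect_def x_rhs_def z_rhs_def pred_err_def matrix_vector_mult_diff_distrib)
  moreover have "fst (fnl (a, snd (wnl a))) = rnl a"
    by (simp add: rnl_def manifold_point_eq)
  ultimately have eq: "pred_defect t \<tau> = Ar *v (pred_err \<tau> - pred_err t) + fst (fnl (x \<tau>) - fnl (a, snd (wnl a)))
      + (rnl a - rnl (zr t)) + (rnl (zr t) - rnl (zr \<tau>)) + fst (d \<tau>)"
    by simp
  have "norm (fst (fnl (x \<tau>) - fnl (a, snd (wnl a)))) \<le> Lf * norm (x \<tau> - x t) + Lf * norm (normal_dev t)"
    using order_trans[OF norm_fst_le_norm norm_fnl_sub_manifold_le] by (simp add: a_def)
  moreover have "norm (rnl a - rnl (zr t)) \<le> Lr * norm (pred_err t)"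
    using norm_rnl_diff_le by (simp add: a_def pred_err_def)
  moreover have "norm (rnl (zr t) - rnl (zr \<tau>)) \<le> Lr * norm (zr \<tau> - zr t)"
    using norm_rnl_diff_le[of "zr t" "zr \<tau>"] by (simp add: norm_minus_commute)
  moreover have "norm (fst (d \<tau>)) \<le> dbar"
    using norm_fst_le_norm[of "d \<tau>"] d_bound assms by force
  moreover note norm_mult_vec_le_onorm[of Ar "pred_err \<tau> - pred_err t"]
  moreover have "norm (Ar *v (pred_err \<tau> - pred_err t) + fst (fnl (x \<tau>) - fnl (a, snd (wnl a)))
      + (rnl a - rnl (zr t)) + (rnl (zr t) - rnl (zr \<tau>)) + fst (d \<tau>))
    \<le> norm (Ar *v (pred_err \<tau> - pred_err t)) + norm (fst (fnl (x \<tau>) - fnl (a, snd (wnl a))))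
      + norm (rnl a - rnl (zr t)) + norm (rnl (zr t) - rnl (zr \<tau>)) + norm (fst (d \<tau>))"
    by (intro order_trans[OF norm_triangle_ineq] add_mono order_refl)
  ultimately show ?thesis
    unfolding eq by linarith
qed

lemma q_r_integrable: "0 \<le> t \<Longrightarrow> t \<le> t' \<Longrightarrow> q_r integrable_on {t..t'}"
  using integrable_subinterval_real[OF integral_solution_affine_integrable[OF \<delta>_integral_solution, of t']]
  by simp

lemma norm_pred_err_step_le:
  assumes "0 \<le> t" and "t \<le> t'"
    and "(t' - t) * \<bar>max_re_eig Ar\<bar> \<le> 1/2" and "(t' - t) * (onorm ((*v) Ar))\<^sup>2 * norm (pred_err t) \<le> e"
    and close: "\<And>\<tau>. \<tau> \<in> {t..t'} \<Longrightarrow> norm (pred_err \<tau> - pred_err t) \<le> e \<and> norm (x \<tau> - x t) \<le> e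
      \<and> norm (zr \<tau> - zr t) \<le> e \<and> s t \<le> s \<tau> + e"
  shows "norm (pred_err t') \<le> norm (pred_err t) + (t' - t) * k_r * norm (pred_err t)
    + integral {t..t'} q_r + e * (t' - t) * (1 + c_r)"
proof -
  define h N where "h = t' - t" and "N = norm (pred_err t)"
  define I where "I = pred_err t' - pred_err t - h *\<^sub>R (Ar *v pred_err t)"
  have euler: "norm (pred_err t + h *\<^sub>R (Ar *v pred_err t)) \<le> (1 + h * max_re_eig Ar) * N + e * h"
    unfolding N_def using assms(2-4)
    by (intro norm_euler_step_le_eps real_block_diag_inner_le_max_re_eig[OF A_block_r])
      (simp_all add: h_def norm_mult_vec_le_onorm)
  have "norm I \<le> h * (c_r * e + Lr * N) + integral {t..t'} q_r"
  proof (unfold h_def, rule norm_has_integral_le_affine)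
    show "(pred_defect t has_integral I) {t..t'}"
      unfolding I_def h_def using pred_err_increment[OF assms(1,2)] .
    fix \<tau> assume "\<tau> \<in> {t..t'}"
    then have "norm (pred_err \<tau> - pred_err t) \<le> e" "norm (x \<tau> - x t) \<le> e" "norm (zr \<tau> - zr t) \<le> e"
      and "norm (normal_dev t) \<le> s \<tau> + e"
      using close[of \<tau>] norm_normal_dev_le[OF \<open>0 \<le> t\<close>] by auto
    then have "onorm ((*v) Ar) * norm (pred_err \<tau> - pred_err t) \<le> onorm ((*v) Ar) * e"
      and "Lf * norm (x \<tau> - x t) \<le> Lf * e" and "Lf * norm (normal_dev t) \<le> Lf * (s \<tau> + e)"
      and "Lr * norm (zr \<tau> - zr t) \<le> Lr * e"
      using onorm_mult_vec_nonneg[of Ar] lipschitz_constants_nonneg by (auto intro: mult_left_mono)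
    then have "norm (pred_defect t \<tau>) \<le> onorm ((*v) Ar) * e + Lf * e + Lf * (s \<tau> + e) + Lr * N + Lr * e + dbar"
      using norm_pred_defect_le[of \<tau> t] \<open>\<tau> \<in> {t..t'}\<close> \<open>0 \<le> t\<close> by (simp add: N_def)
    then show "norm (pred_defect t \<tau>) \<le> c_r * e + Lr * N + q_r \<tau>"
      by (simp add: c_r_def q_r_def algebra_simps)
  qed (use assms(1,2) q_r_integrable in auto)
  moreover have "norm (pred_err t') \<le> norm (pred_err t + h *\<^sub>R (Ar *v pred_err t)) + norm I"
    using norm_triangle_ineq[of "pred_err t + h *\<^sub>R (Ar *v pred_err t)" I] by (simp add: I_def)
  ultimately have "norm (pred_err t') \<le> (1 + h * max_re_eig Ar) * N + e * h + (h * (c_r * e + Lr * N) + integral {t..t'} q_r)"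
    using euler by linarith
  then show ?thesis
    by (simp add: h_def N_def k_r_def algebra_simps)
qed

lemma pred_err_euler_subsolution:
  assumes "0 \<le> T"
  shows "euler_subsolution T k_r q_r (\<lambda>_. 0) (\<lambda>t. norm (pred_err t))"
proof (rule euler_subsolutionI[where C="1 + c_r"])
  show "0 \<le> 1 + c_r"
    using c_r_nonneg by simp
  obtain Me where "0 \<le> Me" and Me: "\<And>t. t \<in> {0..T} \<Longrightarrow> norm (pred_err t) \<le> Me"
    using continuous_on_Icc_norm_bound[OF pred_err_continuous_on[OF \<open>0 \<le> T\<close>]] by blast
  have "continuous_on {0..T} (\<lambda>t. (pred_err t, x t, zr t, s t))"
    using pred_err_continuous_on[OF \<open>0 \<le> T\<close>] integral_solution_continuous_on[OF x_integral_solution \<open>0 \<le> T\<close>]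
      integral_solution_continuous_on[OF zr_integral_solution \<open>0 \<le> T\<close>]
      integral_solution_continuous_on[OF s_integral_solution \<open>0 \<le> T\<close>]
    by (intro continuous_on_Pair)
  fix \<epsilon> :: real assume "\<epsilon> > 0"
  then obtain \<eta>\<^sub>c where "\<eta>\<^sub>c > 0" and modulus: "\<And>\<tau> t. \<tau> \<in> {0..T} \<Longrightarrow> t \<in> {0..T} \<Longrightarrow> \<bar>t - \<tau>\<bar> < \<eta>\<^sub>c \<Longrightarrow>
      dist (pred_err t, x t, zr t, s t) (pred_err \<tau>, x \<tau>, zr \<tau>, s \<tau>) < \<epsilon>"
    using continuous_on_Icc_uniform_modulus[OF \<open>continuous_on {0..T} _\<close>] by blast
  obtain \<eta>\<^sub>E where "\<eta>\<^sub>E > 0" and euler: "\<And>h a. 0 \<le> h \<Longrightarrow> h < \<eta>\<^sub>E \<Longrightarrow> a \<le> Me \<Longrightarrow>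
      h * \<bar>max_re_eig Ar\<bar> \<le> 1/2 \<and> h * (onorm ((*v) Ar))\<^sup>2 * a \<le> \<epsilon>"
    using euler_step_size[OF \<open>0 \<le> Me\<close> \<open>\<epsilon> > 0\<close>] by blast
  show "\<exists>\<eta>>0. \<forall>t t'. 0 \<le> t \<longrightarrow> t \<le> t' \<longrightarrow> t' \<le> T \<longrightarrow> t' - t < \<eta> \<longrightarrow>
    norm (pred_err t') \<le> norm (pred_err t) + (t' - t) * k_r * norm (pred_err t) + integral {t..t'} q_r
      + (1 + c_r) * \<epsilon> * ((t' - t) + integral {t..t'} (\<lambda>_. 0))"
  proof (intro exI[of _ "min \<eta>\<^sub>c \<eta>\<^sub>E"] conjI allI impI)
    show "min \<eta>\<^sub>c \<eta>\<^sub>E > 0"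
      using \<open>\<eta>\<^sub>c > 0\<close> \<open>\<eta>\<^sub>E > 0\<close> by simp
    fix t t' assume t: "0 \<le> t" "t \<le> t'" "t' \<le> T" "t' - t < min \<eta>\<^sub>c \<eta>\<^sub>E"
    have "norm (pred_err \<tau> - pred_err t) \<le> \<epsilon> \<and> norm (x \<tau> - x t) \<le> \<epsilon> \<and> norm (zr \<tau> - zr t) \<le> \<epsilon>
        \<and> s t \<le> s \<tau> + \<epsilon>" if "\<tau> \<in> {t..t'}" for \<tau>
    proof -
      have "norm ((pred_err \<tau>, x \<tau>, zr \<tau>, s \<tau>) - (pred_err t, x t, zr t, s t)) < \<epsilon>"
        using modulus[of t \<tau>] that t by (auto simp: dist_norm)
      then show ?thesis
        using norm_fst_le[where x="pred_err \<tau> - pred_err t" and y="(x \<tau> - x t, zr \<tau> - zr t, s \<tau> - s t)"]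
          norm_snd_le[where x="pred_err \<tau> - pred_err t" and y="(x \<tau> - x t, zr \<tau> - zr t, s \<tau> - s t)"]
          norm_fst_le[where x="x \<tau> - x t" and y="(zr \<tau> - zr t, s \<tau> - s t)"]
          norm_snd_le[where x="x \<tau> - x t" and y="(zr \<tau> - zr t, s \<tau> - s t)"]
          norm_fst_le[where x="zr \<tau> - zr t" and y="s \<tau> - s t"] norm_snd_le[where x="zr \<tau> - zr t" and y="s \<tau> - s t"]
        by (auto simp: abs_le_iff)
    qed
    then show "norm (pred_err t') \<le> norm (pred_err t) + (t' - t) * k_r * norm (pred_err t)
        + integral {t..t'} q_r + (1 + c_r) * \<epsilon> * ((t' - t) + integral {t..t'} (\<lambda>_. 0))"
      using norm_pred_err_step_le[OF t(1,2)] euler[of "t' - t" "norm (pred_err t)"] Me[of t] t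
      by (simp add: algebra_simps)
  qed
qed simp

lemma norm_pred_err_le:
  assumes "0 \<le> t"
  shows "norm (pred_err t) \<le> \<delta> t"
proof (rule euler_subsolution_le_integral_solution[where N="\<lambda>t. norm (pred_err t)" and \<rho>="\<lambda>_. 0",
      OF assms _ \<delta>_integral_solution _ _ pred_err_euler_subsolution[OF assms]])
  show "norm (pred_err 0) \<le> \<delta> 0"
    using init_r by (simp add: pred_err_def)
qed (simp_all add: integrable_0)

end

theorem proposition1:
  fixes Ar :: "real^('r::{finite,linorder})^('r::{finite,linorder})" and An :: "real^('c::{finite,linorder})^('c::{finite,linorder})"
    and Br :: "real^('m::finite)^('r::{finite,linorder})" and Bn :: "real^'m^('c::{finite,linorder})"
    and fnl :: "(real^('r::{finite,linorder})) \<times> (real^('c::{finite,linorder})) \<Rightarrow> (real^('r::{finite,linorder})) \<times> (real^('c::{finite,linorder}))"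
    and wnl :: "real^('r::{finite,linorder}) \<Rightarrow> (real^('r::{finite,linorder})) \<times> (real^('c::{finite,linorder}))"
    and wnl' :: "real^('r::{finite,linorder}) \<Rightarrow> ((real^('r::{finite,linorder})) \<Rightarrow>\<^sub>L ((real^('r::{finite,linorder})) \<times> (real^('c::{finite,linorder}))))"
    and g :: "real^('r::{finite,linorder}) \<Rightarrow> real^('r::{finite,linorder})"
    and Lf Lw Lr dbar :: real
    and u :: "real \<Rightarrow> real^'m" and d :: "real \<Rightarrow> (real^('r::{finite,linorder})) \<times> (real^('c::{finite,linorder}))"
    and x :: "real \<Rightarrow> (real^('r::{finite,linorder})) \<times> (real^('c::{finite,linorder}))" and zr :: "real \<Rightarrow> real^('r::{finite,linorder})"
    and s \<delta> :: "real \<Rightarrow> real"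
  assumes A_block_r: "real_block_diag Ar" and A_block_n: "real_block_diag An"
    and A_order_r: "ordered_slow_to_fast Ar" and A_order_n: "ordered_slow_to_fast An"
    and A_order_rn: "\<forall>i j. An $ j $ j \<le> Ar $ i $ i"
    and A_hurwitz: "hurwitz Ar" "hurwitz An"
    and f_smooth: "smooth_everywhere fnl"
    and f_zero: "fnl 0 = 0"
    and f_deriv0: "(fnl has_derivative (\<lambda>_. 0)) (at 0)"
    and f_lip: "Lf-lipschitz_on UNIV fnl"
    and w_deriv: "\<forall>xr. (wnl has_derivative blinfun_apply (wnl' xr)) (at xr)"
    and w_C1: "continuous_on UNIV wnl'"
    and w_lip: "Lw-lipschitz_on UNIV wnl"
    and W_inv: "\<forall>xr. fst ((xr, 0) + wnl xr) = xr"
    and W_invariant: "\<forall>xr. (Ar *v fst ((xr, 0) + wnl xr), An *v snd ((xr, 0) + wnl xr))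
                          + fnl ((xr, 0) + wnl xr)
                        = (g xr, 0) + blinfun_apply (wnl' xr) (g xr)"
    and r_lip: "Lr-lipschitz_on UNIV (\<lambda>xr. fst (fnl ((xr, 0) + wnl xr)))"
    and u_loc_int: "\<forall>T\<ge>0. u absolutely_integrable_on {0..T}"
    and d_bound: "\<forall>t\<ge>0. norm (d t) \<le> dbar"
    and x_sol: "\<forall>t\<ge>0. ((\<lambda>\<tau>. (Ar *v fst (x \<tau>), An *v snd (x \<tau>)) + fnl (x \<tau>)
                              + (Br *v u \<tau>, Bn *v u \<tau>) + d \<tau>)
                        has_integral (x t - x 0)) {0..t}"
    and z_sol: "\<forall>t\<ge>0. ((\<lambda>\<tau>. Ar *v zr \<tau> + fst (fnl ((zr \<tau>, 0) + wnl (zr \<tau>))) + Br *v u \<tau>)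
                        has_integral (zr t - zr 0)) {0..t}"
    and s_sol: "\<forall>t\<ge>0. ((\<lambda>\<tau>. max_re_eig An * s \<tau> + (1 + Lw) * (Lf * s \<tau> + dbar)
                              + norm (Bn *v u \<tau>) + Lw * norm (Br *v u \<tau>))
                        has_integral (s t - s 0)) {0..t}"
    and \<delta>_sol: "\<forall>t\<ge>0. ((\<lambda>\<tau>. (max_re_eig Ar + Lr) * \<delta> \<tau> + Lf * s \<tau> + dbar)
                        has_integral (\<delta> t - \<delta> 0)) {0..t}"
    and s0: "s 0 \<ge> 0" and \<delta>0: "\<delta> 0 \<ge> 0"
    and init_n: "norm (snd (x 0) - snd (wnl (fst (x 0)))) \<le> s 0"
    and init_r: "norm (fst (x 0) - zr 0) \<le> \<delta> 0"
  shows "\<forall>t\<ge>0. norm (snd (x t) - snd (wnl (fst (x t)))) \<le> s t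
              \<and> norm (fst (x t) - zr t) \<le> \<delta> t"
proof -
  interpret ssm_prediction Ar An Br Bn fnl wnl wnl' g Lf Lw Lr dbar u d x zr s \<delta>
    unfolding ssm_prediction_def integral_solution_def
    using A_block_r A_block_n f_zero f_lip w_deriv w_C1 w_lip W_inv W_invariant r_lip u_loc_int d_bound
      x_sol z_sol s_sol \<delta>_sol init_n init_r
    by blast
  show ?thesis
    using norm_normal_dev_le norm_pred_err_le by (simp add: normal_dev_def pred_err_def)
qed

end
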